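(* Let $\alpha,\beta>-1$. For each $f\in\ell^2(\mathbb{N})$, the function $(n,t)\mapsto W_t^{(\alpha,\beta)}f(n)$ is the unique solution in the space $\ell^2_\star$ of the initial-value problem $$\frac{\partial u(n,t)}{\partial t}=\mathcal{J}^{(\alpha,\beta)}u(n,t),\quad n\ge 0,\ t\ge 0,\qquad u(n,0)=f(n),\quad n\ge 0,$$ where $$\ell^2_\star=\Big\{u(n,t): \Big\{\sup_{t>0}|u(n,t)|\Big\}_{n\ge 0}\in\ell^2(\mathbb{N})\Big\}.$$
   Context: Here $\mathbb{N}=\{0,1,2,\dots\}$, sequences are real-valued, and $u:\mathbb{N}\times[0,\infty)\to\mathbb{R}$ (derivative at $t=0$ one-sided). Define $$a_n^{(\alpha,\beta)}=\tfrac{2}{2n+\alpha+\beta+2}\sqrt{\tfrac{(n+1)(n+\alpha+1)(n+\beta+1)(n+\alpha+\beta+1)}{(2n+\alpha+\beta+1)(2n+\alpha+\beta+3)}}\ (n\ge1),\qquad a_0^{(\alpha,\beta)}=\tfrac{2}{\alpha+\beta+2}\sqrt{\tfrac{(\alpha+1)(\beta+1)}{\alpha+\beta+3}},$$ $$b_n^{(\alpha,\beta)}=\tfrac{\beta^2-\alpha^2}{(2n+\alpha+\beta)(2n+\alpha+\beta+2)}\ (n\ge1),\qquad b_0^{(\alpha,\beta)}=\tfrac{\beta-\alpha}{\alpha+\beta+2}.$$ Set $J^{(\alpha,\beta)}f(n)=a_{n-1}^{(\alpha,\beta)}f(n-1)+b_n^{(\alpha,\beta)}f(n)+a_n^{(\alpha,\beta)}f(n+1)$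 for $n\ge1$, $J^{(\alpha,\beta)}f(0)=b_0^{(\alpha,\beta)}f(0)+a_0^{(\alpha,\beta)}f(1)$, and $\mathcal{J}^{(\alpha,\beta)}=J^{(\alpha,\beta)}-I$, acting on the variable $n$. Let $P_n^{(\alpha,\beta)}$ be the Jacobi polynomials, defined by $(1-x)^\alpha(1+x)^\beta P_n^{(\alpha,\beta)}(x)=\frac{(-1)^n}{2^nn!}\frac{d^n}{dx^n}\big((1-x)^{\alpha+n}(1+x)^{\beta+n}\big)$, let $d\mu_{\alpha,\beta}(x)=(1-x)^\alpha(1+x)^\beta dx$ on $[-1,1]$, and let $p_n^{(\alpha,\beta)}=P_n^{(\alpha,\beta)}/\|P_n^{(\alpha,\beta)}\|_{L^2([-1,1],d\mu_{\alpha,\beta})}$; these satisfy $J^{(\alpha,\beta)}p_n^{(\alpha,\beta)}(x)=xp_n^{(\alpha,\beta)}(x)$. For $t\ge0$, $$K_t^{(\alpha,\beta)}(m,n)=\int_{-1}^1e^{-(1-x)t}p_m^{(\alpha,\beta)}(x)p_n^{(\alpha,\beta)}(x)\,d\mu_{\alpha,\beta}(x),\qquad W_t^{(\alpha,\beta)}f(n)=\sum_{m=0}^\infty f(m)K_t^{(\alpha,\beta)}(m,n).$$ *)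

theory Defs
  imports "HOL-Analysis.Analysis" "HOL-Computational_Algebra.Polynomial"
begin

definition jacobi_a :: "real \<Rightarrow> real \<Rightarrow> nat \<Rightarrow> real" where
  "jacobi_a \<alpha> \<beta> n =
     (if n = 0
      then 2 / (\<alpha> + \<beta> + 2) * sqrt ((\<alpha> + 1) * (\<beta> + 1) / (\<alpha> + \<beta> + 3))
      else 2 / (2 * real n + \<alpha> + \<beta> + 2) *
           sqrt ((real n + 1) * (real n + \<alpha> + 1) * (real n + \<beta> + 1) * (real n + \<alpha> + \<beta> + 1) /
                 ((2 * real n + \<alpha> + \<beta> + 1) * (2 * real n + \<alpha> + \<beta> + 3))))"

definition jacobi_b :: "real \<Rightarrow> real \<Rightarrow> nat \<Rightarrow> real" where
  "jacobi_b \<alpha> \<beta> n =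
     (if n = 0
      then (\<beta> - \<alpha>) / (\<alpha> + \<beta> + 2)
      else (\<beta>\<^sup>2 - \<alpha>\<^sup>2) / ((2 * real n + \<alpha> + \<beta>) * (2 * real n + \<alpha> + \<beta> + 2)))"

definition jacobi_J :: "real \<Rightarrow> real \<Rightarrow> (nat \<Rightarrow> real) \<Rightarrow> nat \<Rightarrow> real" where
  "jacobi_J \<alpha> \<beta> f n =
     (if n = 0
      then jacobi_b \<alpha> \<beta> 0 * f 0 + jacobi_a \<alpha> \<beta> 0 * f 1
      else jacobi_a \<alpha> \<beta> (n - 1) * f (n - 1) + jacobi_b \<alpha> \<beta> n * f n + jacobi_a \<alpha> \<beta> n * f (n + 1))"

definition jacobi_calJ :: "real \<Rightarrow> real \<Rightarrow> (nat \<Rightarrow> real) \<Rightarrow> nat \<Rightarrow> real" where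
  "jacobi_calJ \<alpha> \<beta> f n = jacobi_J \<alpha> \<beta> f n - f n"

text \<open>Rodrigues' formula is imposed on the open interval, where both weights are smooth; this
  determines the polynomial, as shown in \<open>rodrigues_unique\<close> below.\<close>

definition rodrigues :: "real \<Rightarrow> real \<Rightarrow> nat \<Rightarrow> real poly \<Rightarrow> bool" where
  "rodrigues \<alpha> \<beta> n P \<longleftrightarrow>
     (\<forall>x\<in>{-1<..<1}.
        (1 - x) powr \<alpha> * (1 + x) powr \<beta> * poly P x =
        (-1) ^ n / (2 ^ n * fact n) *
        (deriv ^^ n) (\<lambda>y. (1 - y) powr (\<alpha> + real n) * (1 + y) powr (\<beta> + real n)) x)"

definition jacobi_P :: "real \<Rightarrow> real \<Rightarrow> nat \<Rightarrow> real poly" where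
  "jacobi_P \<alpha> \<beta> n = (THE P. rodrigues \<alpha> \<beta> n P)"

lemma iterated_deriv_weight:
  fixes a b :: real
  shows "\<exists>q. \<forall>x\<in>{-1<..<1}.
    (deriv ^^ k) (\<lambda>y. (1 - y) powr a * (1 + y) powr b) x =
    (1 - x) powr (a - real k) * (1 + x) powr (b - real k) * poly q x"
proof (induction k)
  case 0
  show ?case by (rule exI[of _ 1]) simp
next
  case (Suc k)
  let ?g = "(deriv ^^ k) (\<lambda>y. (1 - y) powr a * (1 + y) powr b)"
  define A where "A = a - real k"
  define B where "B = b - real k"
  from Suc obtain q where q: "\<And>x. x \<in> {-1<..<1} \<Longrightarrow>
      ?g x = (1 - x) powr A * (1 + x) powr B * poly q x"
    unfolding A_def B_def by blast
  define r where "r = smult (-A) ([:1, 1:] * q) + smult B ([:1, -1:] * q)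
                      + [:1, -1:] * [:1, 1:] * pderiv q"
  have "deriv ?g x = (1 - x) powr (A - 1) * (1 + x) powr (B - 1) * poly r x"
    if x: "x \<in> {-1<..<1}" for x
  proof -
    have pos: "1 - x > 0" "1 + x > 0" using x by auto
    let ?h = "\<lambda>x. (1 - x) powr A * (1 + x) powr B * poly q x"
    have "(?h has_real_derivative
        (- (A * (1 - x) powr (A - 1)) * (1 + x) powr B
         + (1 - x) powr A * (B * (1 + x) powr (B - 1))) * poly q x
         + (1 - x) powr A * (1 + x) powr B * poly (pderiv q) x) (at x)"
      using pos by (auto intro!: derivative_eq_intros simp: algebra_simps powr_diff)
    also have "(1 - x) powr A = (1 - x) powr (A - 1) * (1 - x)"
      using pos by (simp add: powr_diff)
    also have "(1 + x) powr B = (1 + x) powr (B - 1) * (1 + x)"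
      using pos by (simp add: powr_diff)
    finally have h: "(?h has_real_derivative
        (1 - x) powr (A - 1) * (1 + x) powr (B - 1) * poly r x) (at x)"
      by (rule DERIV_cong) (simp add: r_def algebra_simps)
    have "(?g has_real_derivative
        (1 - x) powr (A - 1) * (1 + x) powr (B - 1) * poly r x) (at x)"
      by (rule has_field_derivative_transform_within_open[OF h, of "{-1<..<1}"])
         (use x q in auto)
    then show ?thesis by (rule DERIV_imp_deriv)
  qed
  then show ?case
    by (intro exI[of _ r]) (simp add: A_def B_def algebra_simps)
qed

lemma rodrigues_unique: "\<exists>!P. rodrigues \<alpha> \<beta> n P"
proof -
  obtain q where q: "\<And>x. x \<in> {-1<..<1} \<Longrightarrow>
    (deriv ^^ n) (\<lambda>y. (1 - y) powr (\<alpha> + real n) * (1 + y) powr (\<beta> + real n)) x =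
    (1 - x) powr \<alpha> * (1 + x) powr \<beta> * poly q x"
    using iterated_deriv_weight[of n "\<alpha> + real n" "\<beta> + real n"] by auto
  have ex: "rodrigues \<alpha> \<beta> n (smult ((-1) ^ n / (2 ^ n * fact n)) q)"
    unfolding rodrigues_def by (simp add: q)
  have "P = Q" if P: "rodrigues \<alpha> \<beta> n P" and Q: "rodrigues \<alpha> \<beta> n Q" for P Q
  proof (rule ccontr)
    assume "P \<noteq> Q"
    then have "finite {x. poly (P - Q) x = 0}" by (intro poly_roots_finite) simp
    moreover have "{-1<..<1::real} \<subseteq> {x. poly (P - Q) x = 0}"
    proof
      fix x :: real assume x: "x \<in> {-1<..<1}"
      have "(1 - x) powr \<alpha> * (1 + x) powr \<beta> * poly P x
          = (1 - x) powr \<alpha> * (1 + x) powr \<beta> * poly Q x"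
        using P Q x unfolding rodrigues_def by simp
      then show "x \<in> {x. poly (P - Q) x = 0}" using x by simp
    qed
    ultimately have "finite {-1<..<1::real}" by (rule rev_finite_subset)
    then show False using infinite_Ioo[of "-1::real" 1] by simp
  qed
  with ex show ?thesis by blast
qed

text \<open>The density is only relevant up to null sets, so the values of \<open>powr\<close> at \<open>x = -1\<close> and
  \<open>x = 1\<close> (where \<open>0 powr s = 0\<close> for every \<open>s\<close>) play no role.\<close>

definition jacobi_measure :: "real \<Rightarrow> real \<Rightarrow> real measure" where
  "jacobi_measure \<alpha> \<beta> =
     density lborel (\<lambda>x. ennreal (indicator {-1..1} x * ((1 - x) powr \<alpha> * (1 + x) powr \<beta>)))"

definition jacobi_p :: "real \<Rightarrow> real \<Rightarrow> nat \<Rightarrow> real \<Rightarrow> real" where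
  "jacobi_p \<alpha> \<beta> n x =
     poly (jacobi_P \<alpha> \<beta> n) x / sqrt (\<integral>y. (poly (jacobi_P \<alpha> \<beta> n) y)\<^sup>2 \<partial>jacobi_measure \<alpha> \<beta>)"

definition heat_kernel :: "real \<Rightarrow> real \<Rightarrow> real \<Rightarrow> nat \<Rightarrow> nat \<Rightarrow> real" where
  "heat_kernel \<alpha> \<beta> t m n =
     (\<integral>x. exp (- (1 - x) * t) * jacobi_p \<alpha> \<beta> m x * jacobi_p \<alpha> \<beta> n x \<partial>jacobi_measure \<alpha> \<beta>)"

definition heat_W :: "real \<Rightarrow> real \<Rightarrow> real \<Rightarrow> (nat \<Rightarrow> real) \<Rightarrow> nat \<Rightarrow> real" where
  "heat_W \<alpha> \<beta> t f n = (\<Sum>m. f m * heat_kernel \<alpha> \<beta> t m n)"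

definition l2 :: "(nat \<Rightarrow> real) set" where
  "l2 = {f. summable (\<lambda>n. (f n)\<^sup>2)}"

text \<open>Boundedness is explicit because \<open>SUP\<close> on the reals is unspecified on unbounded sets.\<close>

definition l2_star :: "(nat \<Rightarrow> real \<Rightarrow> real) set" where
  "l2_star = {u. (\<forall>n. bdd_above ((\<lambda>t. \<bar>u n t\<bar>) ` {0<..})) \<and>
                 (\<lambda>n. SUP t\<in>{0<..}. \<bar>u n t\<bar>) \<in> l2}"

text \<open>Functions on \<open>\<nat> \<times> [0, \<infinity>)\<close> are represented by \<open>u :: nat \<Rightarrow> real \<Rightarrow> real\<close>, whose values at
  negative times are ignored; the derivative within \<open>{0..}\<close> is one-sided at \<open>t = 0\<close>.\<close>

definition solves_heat_ivp ::
    "real \<Rightarrow> real \<Rightarrow> (nat \<Rightarrow> real) \<Rightarrow> (nat \<Rightarrow> real \<Rightarrow> real) \<Rightarrow> bool" where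
  "solves_heat_ivp \<alpha> \<beta> f u \<longleftrightarrow>
     (\<forall>n. \<forall>t\<ge>0. (u n has_real_derivative jacobi_calJ \<alpha> \<beta> (\<lambda>k. u k t) n) (at t within {0..})) \<and>
     (\<forall>n. u n 0 = f n)"

end

theory Submission
  imports Defs
begin

text \<open>
  \<^bold>\<open>The spectral picture.\<close> The normalised Jacobi polynomials are orthonormal in
  \<open>L\<^sup>2(\<mu>)\<close> for the Jacobi measure \<open>\<mu>\<close>, which lives on \<open>[-1, 1]\<close>, and the matrix \<open>J\<close> acts on
  them as multiplication by \<open>x\<close>. Hence \<open>W\<^sub>t\<close> is \<open>exp (t (J - I))\<close>: it corresponds to
  multiplication by \<open>exp (- (1 - x) t)\<close>. Orthonormality and the recurrence come from Rodrigues'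
  formula, which writes \<open>P\<^sub>n\<^sup>(\<alpha>\<^sup>,\<^sup>\<beta>\<^sup>)\<close> as a first-order differential operator applied to
  \<open>P\<^sub>n\<^sub>-\<^sub>1\<^sup>(\<alpha>\<^sup>+\<^sup>1\<^sup>,\<^sup>\<beta>\<^sup>+\<^sup>1\<^sup>)\<close>. Leading coefficients, norms and integrals against polynomials all
  follow from it by induction on \<open>n\<close> with varying \<open>\<alpha>\<close> and \<open>\<beta>\<close>; see
  \<open>jacobi_opoly_orthonormal\<close> and \<open>jacobi_opoly_recurrence\<close>. Everything after that uses only
  these two facts and the signs \<open>a\<^sub>n \<ge> 0\<close>, which are collected in the locale
  \<open>jacobi_matrix_measure\<close>.

  \<^bold>\<open>The maximal function.\<close> The substantial claim is that \<open>sup\<^sub>t \<bar>W\<^sub>t f(n)\<bar>\<close> is in \<open>\<ell>\<^sup>2\<close>.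
  Put \<open>T = (I + J) / 2\<close>. It is symmetric, it has spectrum in \<open>[0, 1]\<close>, and its entries are
  nonnegative, because \<open>a\<^sub>n \<ge> 0\<close> and \<open>b\<^sub>n = \<integral>x p\<^sub>n\<^sup>2 d\<mu> \<ge> -1\<close>. Since
  \<open>W\<^sub>t = exp (-2t) \<Sum>\<^sub>k (2t)\<^sup>k / k! T\<^sup>k\<close> is an average of powers of \<open>T\<close>, it suffices to bound
  \<open>sup\<^sub>k \<bar>T\<^sup>k f\<bar>\<close> in \<open>\<ell>\<^sup>2\<close>. As in Stein's maximal theorem, \<open>T\<^sup>k\<close> is compared with the mean
  \<open>A\<^sub>k = (I + T + \<dots> + T\<^sup>k) / (k + 1)\<close>.

  The difference \<open>T\<^sup>k - A\<^sub>k\<close> is a weighted sum of the increments \<open>T\<^sup>j - T\<^sup>j\<^sup>-\<^sup>1\<close>, so that the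
  Cauchy-Schwarz inequality bounds it, uniformly in \<open>k\<close>, by the square function
  \<open>(\<Sum>\<^sub>j j \<bar>(T\<^sup>j - T\<^sup>j\<^sup>-\<^sup>1) f\<bar>\<^sup>2)\<^sup>1\<^sup>/\<^sup>2\<close>; this has \<open>\<ell>\<^sup>2\<close> norm at most that of \<open>f\<close>, because
  \<open>\<Sum>\<^sub>j j (y\<^sup>j - y\<^sup>j\<^sup>-\<^sup>1)\<^sup>2 \<le> 1\<close> on \<open>[0, 1]\<close> (\<open>square_function_power\<close>).

  For the means, fix a choice \<open>n \<mapsto> k n\<close> and let \<open>L f (n) = A\<^bsub>k n\<^esub> f (n)\<close>. The kernel of \<open>L L\<^sup>*\<close>
  consists of entries of \<open>A\<^bsub>k n\<^esub> A\<^bsub>k m\<^esub>\<close>, and these are bounded by the corresponding entries of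
  \<open>2 A\<^bsub>2 k n + 1\<^esub> + 2 A\<^bsub>2 k m + 1\<^esub>\<close>, as all entries of powers of \<open>T\<close> are nonnegative. So the
  square of the norm of \<open>L\<close> is at most four times the norm of the operator of the same kind that
  belongs to \<open>2 k + 1\<close>. If \<open>n\<close> is restricted to a finite set, the norms are bounded over all
  choices \<open>k\<close>, and their supremum \<open>S\<close> satisfies \<open>S\<^sup>2 \<le> 4 S\<close>, whence \<open>S \<le> 4\<close> (\<open>integral_mean_sum_sq_le\<close>).

  \<^bold>\<open>The equation and uniqueness.\<close> Each \<open>K\<^sub>t(m, n)\<close> is differentiable in \<open>t\<close>, and the series
  for \<open>W\<^sub>t f(n)\<close> converges uniformly in \<open>t \<ge> 0\<close> by Bessel's inequality, so it can be
  differentiated termwise. If \<open>v\<close> is the difference of two solutions in \<open>\<ell>\<^sup>2\<^sub>\<star>\<close>, the truncated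
  energy \<open>\<Sum>\<^sub>n\<^sub>\<le>\<^sub>N v(n,t)\<^sup>2\<close> has derivative at most \<open>2 \<bar>v(N,t) v(N+1,t)\<bar>\<close>, since \<open>J \<le> I\<close> as a
  quadratic form and only one off-diagonal term crosses the truncation. The bound on
  \<open>sup\<^sub>t \<bar>v(n,t)\<bar>\<close> makes this tend to \<open>0\<close> uniformly in \<open>t\<close> as \<open>N \<rightarrow> \<infinity>\<close>, so \<open>v = 0\<close>
  (\<open>evolution_unique_zero\<close>).
\<close>

section \<open>The Jacobi measure\<close>

lemma space_jacobi_measure [simp]: "space (jacobi_measure a b) = UNIV"
  and sets_jacobi_measure [measurable_cong, simp]: "sets (jacobi_measure a b) = sets borel"
  by (simp_all add: jacobi_measure_def)

text \<open>The substitution \<open>x \<mapsto> (1 + x) / 2\<close> turns the weight into the integrand of the Beta function.\<close>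

lemma jacobi_weight_integrable:
  assumes "a > -1" "b > -1"
  shows "integrable lborel (\<lambda>x::real. indicator {-1..1} x * ((1 - x) powr a * (1 + x) powr b))"
proof -
  have "set_integrable lborel {0..1} (\<lambda>t. t powr (b + 1 - 1) * (1 - t) powr (a + 1 - 1))"
    using assms by (intro integrable_Beta) auto
  then have "integrable lborel (\<lambda>t. indicator {0..1} t *\<^sub>R (t powr b * (1 - t) powr a))"
    by (simp add: set_integrable_def)
  then have "integrable lborel
      (\<lambda>x. indicator {0..1} (1/2 + 1/2 * x) *\<^sub>R
           ((1/2 + 1/2 * x) powr b * (1 - (1/2 + 1/2 * x)) powr a))"
    by (rule lborel_integrable_real_affine) simp
  then have "integrable lborel (\<lambda>x. 2 powr a * 2 powr b * (indicator {0..1} (1/2 + 1/2 * x) *\<^sub>R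
           ((1/2 + 1/2 * x) powr b * (1 - (1/2 + 1/2 * x)) powr a)))"
    by (rule integrable_mult_right)
  also have "(\<lambda>x. 2 powr a * 2 powr b * (indicator {0..1} (1/2 + 1/2 * x) *\<^sub>R
           ((1/2 + 1/2 * x) powr b * (1 - (1/2 + 1/2 * x)) powr a)))
      = (\<lambda>x::real. indicator {-1..1} x * ((1 - x) powr a * (1 + x) powr b))"
  proof
    fix x :: real
    show "2 powr a * 2 powr b * (indicator {0..1} (1/2 + 1/2 * x) *\<^sub>R
           ((1/2 + 1/2 * x) powr b * (1 - (1/2 + 1/2 * x)) powr a))
      = indicator {-1..1} x * ((1 - x) powr a * (1 + x) powr b)"
    proof (cases "x \<in> {-1..1}")
      case True
      have eq: "1/2 + 1/2 * x = (1 + x) / 2" "1 - (1 + x) / 2 = (1 - x) / 2"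
        by (simp_all add: field_simps)
      from True have "(1 + x) / 2 \<in> {0..1}" by auto
      with True show ?thesis unfolding eq by (simp add: powr_divide indicator_def)
    qed (auto simp: indicator_def)
  qed
  finally show ?thesis .
qed

lemma finite_jacobi_measure:
  assumes "a > -1" "b > -1"
  shows "finite_measure (jacobi_measure a b)"
proof
  have "emeasure (jacobi_measure a b) UNIV
      = (\<integral>\<^sup>+x. ennreal (indicator {-1..1} x * ((1 - x) powr a * (1 + x) powr b)) \<partial>lborel)"
    unfolding jacobi_measure_def by (subst emeasure_density) auto
  also have "\<dots> < \<infinity>"
    using jacobi_weight_integrable[OF assms] unfolding integrable_iff_bounded
    by (simp add: abs_mult)
  finally show "emeasure (jacobi_measure a b) (space (jacobi_measure a b)) \<noteq> \<infinity>" by simp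
qed

lemma AE_jacobi_measure: "AE x in jacobi_measure a b. x \<in> {-1..1}"
  unfolding jacobi_measure_def by (subst AE_density) (auto intro!: AE_I2 simp: indicator_def)

lemma integrable_continuous_on_finite_measure:
  fixes g :: "real \<Rightarrow> real"
  assumes "finite_measure M" "sets M = sets borel" "AE x in M. x \<in> {-1..1}"
    and g: "continuous_on UNIV g"
  shows "integrable M g"
proof -
  have "continuous_on {-1..1} g" using g by (rule continuous_on_subset) auto
  then have "bounded (g ` {-1..1})" by (intro compact_imp_bounded compact_continuous_image) auto
  then obtain B where B: "\<And>x. x \<in> {-1..1} \<Longrightarrow> norm (g x) \<le> B"
    unfolding bounded_iff by blast
  have "AE x in M. norm (g x) \<le> B"
    using assms(3) by eventually_elim (rule B)
  moreover have "g \<in> borel_measurable M"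
    using borel_measurable_continuous_onI[OF g] assms(2) by (simp cong: measurable_cong_sets)
  ultimately show ?thesis by (rule finite_measure.integrable_const_bound[OF assms(1)])
qed

definition jacobi_int :: "real \<Rightarrow> real \<Rightarrow> real poly \<Rightarrow> real" where
  "jacobi_int a b q = (\<integral>x. poly q x \<partial>jacobi_measure a b)"

lemma integrable_poly_jacobi_measure:
  assumes "a > -1" "b > -1"
  shows "integrable (jacobi_measure a b) (poly q)"
  by (rule integrable_continuous_on_finite_measure[OF finite_jacobi_measure])
     (use assms AE_jacobi_measure in \<open>auto intro!: continuous_intros\<close>)

lemma jacobi_int_add:
  "a > -1 \<Longrightarrow> b > -1 \<Longrightarrow> jacobi_int a b (p + q) = jacobi_int a b p + jacobi_int a b q"
  unfolding jacobi_int_def poly_add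
  by (rule Bochner_Integration.integral_add) (rule integrable_poly_jacobi_measure; assumption)+

lemma jacobi_int_diff:
  "a > -1 \<Longrightarrow> b > -1 \<Longrightarrow> jacobi_int a b (p - q) = jacobi_int a b p - jacobi_int a b q"
  unfolding jacobi_int_def poly_diff
  by (rule Bochner_Integration.integral_diff) (rule integrable_poly_jacobi_measure; assumption)+

lemma jacobi_int_smult: "jacobi_int a b (smult c p) = c * jacobi_int a b p"
  by (simp add: jacobi_int_def)

lemma jacobi_int_eq_lborel:
  "jacobi_int a b q
    = (\<integral>x. indicator {-1..1} x * ((1 - x) powr a * (1 + x) powr b) * poly q x \<partial>lborel)"
proof -
  have "poly q \<in> borel_measurable lborel"
    by (auto intro!: borel_measurable_continuous_onI continuous_intros)
  then show ?thesis
    unfolding jacobi_int_def jacobi_measure_def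
    by (subst integral_density) auto
qed

text \<open>The weight is positive on \<open>(-1, 1)\<close>, and a nonzero polynomial has only finitely many zeros.\<close>

lemma jacobi_int_square_eq_0D:
  assumes ab: "a > -1" "b > -1" and q: "jacobi_int a b (q * q) = 0"
  shows "q = 0"
proof (rule ccontr)
  assume "q \<noteq> 0"
  have "AE x in jacobi_measure a b. poly (q * q) x = 0"
    using q integral_nonneg_eq_0_iff_AE[OF integrable_poly_jacobi_measure[OF ab], of "q * q"]
    by (simp add: jacobi_int_def del: poly_mult) (simp add: poly_mult[abs_def])
  then have "AE x in lborel. x \<in> {-1<..<1} \<longrightarrow> poly q x = 0"
    unfolding jacobi_measure_def
    by (subst (asm) AE_density) (auto elim!: eventually_mono simp: indicator_def)
  moreover have "AE x in lborel. x \<notin> {x. poly q x = 0}"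
    using \<open>q \<noteq> 0\<close> by (intro AE_not_in finite_imp_null_set_lborel poly_roots_finite)
  ultimately have "AE x in lborel. x \<notin> {-1<..<1::real}"
    by eventually_elim auto
  then have "emeasure lborel {-1<..<1::real} = 0"
    using AE_iff_measurable[of "{-1<..<1::real}" lborel "\<lambda>x. x \<notin> {-1<..<1}"]
    by (simp add: greaterThanLessThan_def greaterThan_def lessThan_def Int_def)
  then show False by simp
qed

section \<open>Rodrigues' formula as a recursion in the parameters\<close>

text \<open>Differentiation of \<open>(1 - x)\<^sup>A (1 + x)\<^sup>B q(x)\<close> lowers both exponents by one and
  replaces \<open>q\<close> by the polynomial \<open>- A (1 + x) q + B (1 - x) q + (1 - x\<^sup>2) q'\<close>.\<close>

definition jacobi_shift :: "real \<Rightarrow> real \<Rightarrow> real poly \<Rightarrow> real poly" where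
  "jacobi_shift A B q =
     smult (- A) ([:1, 1:] * q) + smult B ([:1, -1:] * q) + [:1, 0, -1:] * pderiv q"

lemma has_derivative_weighted_poly:
  assumes "x \<in> {-1<..<1}"
  shows "((\<lambda>x. (1 - x) powr A * (1 + x) powr B * poly q x) has_real_derivative
     (1 - x) powr (A - 1) * (1 + x) powr (B - 1) * poly (jacobi_shift A B q) x) (at x)"
proof -
  have pos: "1 - x > 0" "1 + x > 0" using assms by auto
  have "((\<lambda>x. (1 - x) powr A * (1 + x) powr B * poly q x) has_real_derivative
        (- (A * (1 - x) powr (A - 1)) * (1 + x) powr B
         + (1 - x) powr A * (B * (1 + x) powr (B - 1))) * poly q x
         + (1 - x) powr A * (1 + x) powr B * poly (pderiv q) x) (at x)"
    using pos by (auto intro!: derivative_eq_intros simp: algebra_simps powr_diff)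
  also have "(1 - x) powr A = (1 - x) powr (A - 1) * (1 - x)"
    using pos by (simp add: powr_diff)
  also have "(1 + x) powr B = (1 + x) powr (B - 1) * (1 + x)"
    using pos by (simp add: powr_diff)
  finally show ?thesis
    by (rule DERIV_cong) (simp add: jacobi_shift_def algebra_simps)
qed

text \<open>The integrand is the derivative of a function that vanishes at \<open>-1\<close> and \<open>1\<close>. All integrals
  against the Jacobi weight that are needed below are evaluated by means of this fact.\<close>

lemma jacobi_int_shift:
  assumes "A > 0" "B > 0"
  shows "jacobi_int (A - 1) (B - 1) (jacobi_shift A B q) = 0"
proof -
  let ?F = "\<lambda>x. (1 - x) powr A * (1 + x) powr B * poly q x"
  let ?f = "\<lambda>x. (1 - x) powr (A - 1) * (1 + x) powr (B - 1) * poly (jacobi_shift A B q) x"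
  have "(?f has_integral (?F 1 - ?F (-1))) {-1..1}"
  proof (rule fundamental_theorem_of_calculus_interior)
    show "continuous_on {-1..1} ?F"
      using assms by (intro continuous_intros continuous_on_powr') auto
    show "(?F has_vector_derivative ?f x) (at x)" if "x \<in> {-1<..<1}" for x
      using has_derivative_weighted_poly[OF that, of A B q]
      by (simp add: has_real_derivative_iff_has_vector_derivative)
  qed simp
  then have 0: "(?f has_integral 0) {-1..1}" using assms by simp
  have "integrable (jacobi_measure (A - 1) (B - 1)) (poly (jacobi_shift A B q))"
    using assms by (intro integrable_poly_jacobi_measure) auto
  moreover have "poly (jacobi_shift A B q) \<in> borel_measurable lborel"
    by (auto intro!: borel_measurable_continuous_onI continuous_intros)
  ultimately have "set_integrable lborel {-1..1} ?f"
    unfolding jacobi_measure_def set_integrable_def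
    by (subst (asm) integrable_real_density) (auto simp: mult.assoc)
  from set_borel_integral_eq_integral(2)[OF this] 0 show ?thesis
    by (simp add: jacobi_int_eq_lborel set_lebesgue_integral_def integral_unique mult.assoc)
qed

lemma jacobi_shift_mult:
  "jacobi_shift A B (p * q) = jacobi_shift A B p * q + [:1, 0, -1:] * (p * pderiv q)"
  by (simp add: jacobi_shift_def pderiv_mult algebra_simps smult_add_right)

lemma jacobi_int_weight_shift:
  assumes "a > -1" "b > -1"
  shows "jacobi_int (a + 1) (b + 1) q = jacobi_int a b ([:1, 0, -1:] * q)"
  unfolding jacobi_int_eq_lborel
proof (rule Bochner_Integration.integral_cong)
  fix x :: real
  show "indicator {-1..1} x * ((1 - x) powr (a + 1) * (1 + x) powr (b + 1)) * poly q x =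
        indicator {-1..1} x * ((1 - x) powr a * (1 + x) powr b) * poly ([:1, 0, -1:] * q) x"
    by (cases "x \<in> {-1..1}") (auto simp: powr_mult_base powr_add algebra_simps)
qed simp

lemma jacobi_int_by_parts:
  assumes "a > -1" "b > -1"
  shows "jacobi_int a b (jacobi_shift (a + 1) (b + 1) p * q) = - jacobi_int (a + 1) (b + 1) (p * pderiv q)"
proof -
  have "jacobi_int a b (jacobi_shift (a + 1) (b + 1) (p * q)) = 0"
    using jacobi_int_shift[of "a + 1" "b + 1"] assms by simp
  then show ?thesis
    using assms by (simp add: jacobi_shift_mult jacobi_int_weight_shift jacobi_int_add)
qed

lemma jacobi_int_1_pos:
  assumes "a > -1" "b > -1"
  shows "jacobi_int a b 1 > 0"
proof -
  have "jacobi_int a b 1 \<ge> 0" by (simp add: jacobi_int_def)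
  moreover have "jacobi_int a b 1 \<noteq> 0"
    using jacobi_int_square_eq_0D[OF assms, of 1] by auto
  ultimately show ?thesis by simp
qed

text \<open>Applied to the polynomials \<open>1\<close> and \<open>x\<close>, \<open>jacobi_int_shift\<close> gives two linear relations between
  the moments of order \<open>0\<close>, \<open>1\<close> and \<open>2\<close>; raising both exponents by one multiplies the weight by
  \<open>1 - x\<^sup>2\<close>, whose integral is the difference of the moments of order \<open>0\<close> and \<open>2\<close>.\<close>

lemma jacobi_int_1_step:
  assumes "a > -1" "b > -1"
  shows "(a + b + 2) * (a + b + 3) * jacobi_int (a + 1) (b + 1) 1
       = 4 * (a + 1) * (b + 1) * jacobi_int a b 1"
proof -
  define X where "X k = jacobi_int a b ([:0, 1:] ^ k)" for k
  have X0: "X 0 = jacobi_int a b 1" by (simp add: X_def)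
  have mom: "jacobi_int a b [:c0, c1, c2:] = c0 * X 0 + c1 * X 1 + c2 * X 2" for c0 c1 c2
  proof -
    have "[:c0, c1, c2:] = smult c0 ([:0, 1:] ^ 0) + smult c1 ([:0, 1:] ^ 1) + smult c2 ([:0, 1:] ^ 2)"
      by (simp add: power2_eq_square)
    then show ?thesis
      using assms by (simp only: jacobi_int_add jacobi_int_smult X_def)
  qed
  have sh: "jacobi_int a b (jacobi_shift (a + 1) (b + 1) q) = 0" for q
    using jacobi_int_shift[of "a + 1" "b + 1" q] assms by simp
  have "jacobi_shift (a + 1) (b + 1) 1 = [:b - a, - (a + b + 2), 0:]"
    by (simp add: jacobi_shift_def)
  with sh[of 1] have 1: "(b - a) * X 0 = (a + b + 2) * X 1"
    using mom[of "b - a" "- (a + b + 2)" 0] by (simp add: algebra_simps)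
  have "jacobi_shift (a + 1) (b + 1) [:0, 1:] = [:1, b - a, - (a + b + 3):]"
    by (simp add: jacobi_shift_def pderiv_pCons)
  with sh[of "[:0, 1:]"] have 2: "X 0 + (b - a) * X 1 = (a + b + 3) * X 2"
    using mom[of 1 "b - a" "- (a + b + 3)"] by (simp add: algebra_simps)
  have 3: "jacobi_int (a + 1) (b + 1) 1 = X 0 - X 2"
    using mom[of 1 0 "-1"] assms by (simp add: jacobi_int_weight_shift)
  have "(a + b + 2) * (a + b + 3) * (X 0 - X 2)
      = (a + b + 2) * ((a + b + 3) * X 0) - (a + b + 2) * (X 0 + (b - a) * X 1)"
    unfolding 2 by (simp add: algebra_simps)
  also have "\<dots> = (a + b + 2) * ((a + b + 3) * X 0) - (a + b + 2) * X 0 - (b - a) * ((b - a) * X 0)"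
    unfolding 1 by (simp add: algebra_simps)
  also have "\<dots> = 4 * (a + 1) * (b + 1) * X 0" by algebra
  finally show ?thesis unfolding 3 X0 .
qed

text \<open>The \<open>n\<close>-fold derivative in Rodrigues' formula for \<open>(a, b)\<close> and \<open>n + 1\<close> is, up to a factor, the
  formula for \<open>(a + 1, b + 1)\<close> and \<open>n\<close>, which leaves a single derivative to be taken.\<close>

primrec jacobi_poly :: "nat \<Rightarrow> real \<Rightarrow> real \<Rightarrow> real poly" where
  "jacobi_poly 0 a b = 1"
| "jacobi_poly (Suc n) a b =
     smult (- 1 / (2 * (real n + 1))) (jacobi_shift (a + 1) (b + 1) (jacobi_poly n (a + 1) (b + 1)))"

lemma rodrigues_jacobi_poly: "rodrigues a b n (jacobi_poly n a b)"
proof (induction n arbitrary: a b)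
  case 0
  show ?case by (simp add: rodrigues_def)
next
  case (Suc n)
  let ?w = "\<lambda>y. (1 - y) powr (a + real (Suc n)) * (1 + y) powr (b + real (Suc n))"
  let ?P = "jacobi_poly n (a + 1) (b + 1)"
  let ?c = "(-1) ^ n * (2 ^ n * fact n) :: real"
  have w: "(deriv ^^ n) ?w x = (1 - x) powr (a + 1) * (1 + x) powr (b + 1) * poly (smult ?c ?P) x"
    if "x \<in> {-1<..<1}" for x
  proof -
    have "(1 - x) powr (a + 1) * (1 + x) powr (b + 1) * poly ?P x
       = (-1) ^ n / (2 ^ n * fact n) * (deriv ^^ n) ?w x"
      using Suc[of "a + 1" "b + 1"] that
      unfolding rodrigues_def of_nat_Suc add.assoc by (simp only: add.commute[of 1])
    then have "?c * ((1 - x) powr (a + 1) * (1 + x) powr (b + 1) * poly ?P x)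
       = ?c * ((-1) ^ n / (2 ^ n * fact n)) * (deriv ^^ n) ?w x" by simp
    also have "?c * ((-1) ^ n / (2 ^ n * fact n)) = 1"
      by (simp flip: power_mult_distrib)
    finally show ?thesis by (simp add: mult_ac)
  qed
  show ?case unfolding rodrigues_def
  proof
    fix x :: real assume x: "x \<in> {-1<..<1}"
    have "((deriv ^^ n) ?w has_real_derivative
        (1 - x) powr (a + 1 - 1) * (1 + x) powr (b + 1 - 1)
          * poly (jacobi_shift (a + 1) (b + 1) (smult ?c ?P)) x) (at x)"
      by (rule has_field_derivative_transform_within_open[OF has_derivative_weighted_poly[OF x], of "{-1<..<1}"])
         (use x w in auto)
    then have "(deriv ^^ Suc n) ?w x = (1 - x) powr a * (1 + x) powr b
          * poly (jacobi_shift (a + 1) (b + 1) (smult ?c ?P)) x"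
      by (simp add: DERIV_imp_deriv)
    moreover have "jacobi_shift (a + 1) (b + 1) (smult ?c ?P) = smult ?c (jacobi_shift (a + 1) (b + 1) ?P)"
      by (simp add: jacobi_shift_def pderiv_smult smult_add_right mult_ac)
    ultimately have *: "(deriv ^^ Suc n) ?w x = (1 - x) powr a * (1 + x) powr b * (?c
          * poly (jacobi_shift (a + 1) (b + 1) ?P) x)"
      by simp
    have c: "(-1) ^ Suc n / (2 ^ Suc n * fact (Suc n)) * ?c = - 1 / (2 * (real n + 1))"
    proof -
      have "(-1) ^ Suc n / (2 ^ Suc n * fact (Suc n)) * ?c
          = - ((-1) ^ n * (-1) ^ n) * ((2 ^ n * fact n) / (2 ^ n * fact n)) / (2 * (real n + 1))"
        by (simp add: mult_ac add_ac)
      then show ?thesis by (simp flip: power_mult_distrib)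
    qed
    show "(1 - x) powr a * (1 + x) powr b * poly (jacobi_poly (Suc n) a b) x =
        (-1) ^ Suc n / (2 ^ Suc n * fact (Suc n)) * (deriv ^^ Suc n) ?w x"
      unfolding * by (subst c[symmetric] | simp only: jacobi_poly.simps poly_smult mult_ac)+
  qed
qed

lemma jacobi_P_eq: "jacobi_P a b n = jacobi_poly n a b"
  unfolding jacobi_P_def by (rule the1_equality[OF rodrigues_unique rodrigues_jacobi_poly])

section \<open>Leading coefficients and norms\<close>

lemma coeff_jacobi_shift:
  "coeff (jacobi_shift A B q) (Suc j) =
     (B - A) * coeff q (Suc j) - (A + B + real j) * coeff q j + (real j + 2) * coeff q (Suc (Suc j))"
  by (cases j)
     (simp_all add: jacobi_shift_def coeff_pCons coeff_pderiv algebra_simps split: nat.split)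

lemma coeff_0_jacobi_shift: "coeff (jacobi_shift A B q) 0 = (B - A) * coeff q 0 + coeff q 1"
  by (simp add: jacobi_shift_def coeff_pderiv algebra_simps)

lemma degree_jacobi_poly: "degree (jacobi_poly n a b) \<le> n"
proof (induction n arbitrary: a b)
  case (Suc n)
  let ?P = "jacobi_poly n (a + 1) (b + 1)"
  have "degree (jacobi_shift (a + 1) (b + 1) ?P) \<le> Suc n"
  proof (rule degree_le, intro allI impI)
    fix i assume i: "Suc n < i"
    then obtain j where j: "i = Suc j" "n < j" by (cases i) auto
    then have "coeff ?P j = 0" "coeff ?P (Suc j) = 0" "coeff ?P (Suc (Suc j)) = 0"
      using Suc[of "a + 1" "b + 1"] by (auto intro!: coeff_eq_0)
    then show "coeff (jacobi_shift (a + 1) (b + 1) ?P) i = 0"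
      using j(1) by (simp add: coeff_jacobi_shift)
  qed
  then show ?case by (simp add: degree_smult_eq)
qed simp

definition jacobi_lead :: "nat \<Rightarrow> real \<Rightarrow> real \<Rightarrow> real" where
  "jacobi_lead n a b = coeff (jacobi_poly n a b) n"

lemma jacobi_lead_Suc:
  "jacobi_lead (Suc n) a b = (real n + a + b + 2) / (2 * (real n + 1)) * jacobi_lead n (a + 1) (b + 1)"
proof -
  have "coeff (jacobi_poly n (a + 1) (b + 1)) i = 0" if "n < i" for i
    using degree_jacobi_poly[of n "a + 1" "b + 1"] that by (intro coeff_eq_0) simp
  then show ?thesis
    by (simp add: jacobi_lead_def coeff_jacobi_shift field_simps)
qed

lemma jacobi_lead_0 [simp]: "jacobi_lead 0 a b = 1"
  by (simp add: jacobi_lead_def)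

lemma jacobi_lead_pos:
  assumes "a + b > -2"
  shows "jacobi_lead n a b > 0"
  using assms
proof (induction n arbitrary: a b)
  case (Suc n)
  have "jacobi_lead n (a + 1) (b + 1) > 0" using Suc by simp
  then show ?case using Suc.prems by (simp add: jacobi_lead_Suc)
qed simp

text \<open>The relation is kept free of division, since \<open>n + a + b + 1\<close> vanishes for \<open>n = 0\<close> and
  \<open>a + b = -1\<close>.\<close>

lemma jacobi_lead_ratio:
  "2 * (real n + 1) * (real n + a + b + 1) * jacobi_lead (Suc n) a b
     = (2 * real n + a + b + 1) * (2 * real n + a + b + 2) * jacobi_lead n a b"
proof (induction n arbitrary: a b)
  case 0
  show ?case by (simp add: jacobi_lead_Suc)
next
  case (Suc n)
  define K where "K = jacobi_lead (Suc n) (a + 1) (b + 1)"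
  define L where "L = jacobi_lead n (a + 1) (b + 1)"
  have IH: "2 * (real n + 1) * (real n + a + b + 3) * K
     = (2 * real n + a + b + 3) * (2 * real n + a + b + 4) * L"
    using Suc[of "a + 1" "b + 1"] by (simp add: K_def L_def algebra_simps)
  have "jacobi_lead (Suc (Suc n)) a b = (real n + a + b + 3) / (2 * (real n + 2)) * K"
    by (simp add: jacobi_lead_Suc[of "Suc n"] K_def add_ac)
  moreover have "jacobi_lead (Suc n) a b = (real n + a + b + 2) / (2 * (real n + 1)) * L"
    by (simp add: jacobi_lead_Suc L_def)
  moreover have "2 * (real (Suc n) + 1) * (real (Suc n) + a + b + 1)
        * ((real n + a + b + 3) / (2 * (real n + 2)) * K)
      = (real n + a + b + 2) / (2 * (real n + 1)) * (2 * (real n + 1) * (real n + a + b + 3) * K)"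
    by (simp add: divide_simps) (simp add: algebra_simps)
  ultimately show ?case unfolding IH by (simp add: add_ac mult_ac)
qed

lemma jacobi_sublead:
  assumes "a + b > -2"
  shows "(2 * real n + a + b + 2) * coeff (jacobi_poly (Suc n) a b) n
       = (real n + 1) * (a - b) * jacobi_lead (Suc n) a b"
  using assms
proof (induction n arbitrary: a b)
  case 0
  show ?case by (simp add: coeff_0_jacobi_shift jacobi_lead_Suc field_simps)
next
  case (Suc n)
  define K where "K = jacobi_lead (Suc n) (a + 1) (b + 1)"
  define L where "L = coeff (jacobi_poly (Suc n) (a + 1) (b + 1)) n"
  have IH: "(2 * real n + a + b + 4) * L = (real n + 1) * (a - b) * K"
    using Suc.IH[of "a + 1" "b + 1"] Suc.prems by (simp add: K_def L_def algebra_simps)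
  have "coeff (jacobi_poly (Suc n) (a + 1) (b + 1)) (Suc (Suc n)) = 0"
    using degree_jacobi_poly[of "Suc n" "a + 1" "b + 1"] by (intro coeff_eq_0) simp
  then have 1: "coeff (jacobi_poly (Suc (Suc n)) a b) (Suc n)
      = - 1 / (2 * (real n + 2)) * ((b - a) * K - (real n + a + b + 2) * L)"
    unfolding jacobi_poly.simps(2)[of "Suc n"] coeff_smult coeff_jacobi_shift
    by (simp add: K_def L_def jacobi_lead_def add_ac)
  have 2: "jacobi_lead (Suc (Suc n)) a b = (real n + a + b + 3) / (2 * (real n + 2)) * K"
    by (simp add: jacobi_lead_Suc[of "Suc n"] K_def add_ac)
  have "(2 * real n + a + b + 4) * ((b - a) * K - (real n + a + b + 2) * L)
      = (2 * real n + a + b + 4) * ((b - a) * K) - (real n + a + b + 2) * ((2 * real n + a + b + 4) * L)"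
    by (simp add: algebra_simps)
  also have "\<dots> = - ((real n + 2) * (a - b) * ((real n + a + b + 3) * K))"
    unfolding IH by (simp add: algebra_simps)
  finally have 3: "(2 * real n + a + b + 4) * ((b - a) * K - (real n + a + b + 2) * L)
      = - ((real n + 2) * (a - b) * ((real n + a + b + 3) * K))" .
  have "(2 * real (Suc n) + a + b + 2) * coeff (jacobi_poly (Suc (Suc n)) a b) (Suc n)
     = - 1 / (2 * (real n + 2)) * ((2 * real n + a + b + 4) * ((b - a) * K - (real n + a + b + 2) * L))"
    unfolding 1 by (simp add: add_ac mult_ac)
  also have "\<dots> = (real (Suc n) + 1) * (a - b) * jacobi_lead (Suc (Suc n)) a b"
    unfolding 3 2 by (simp add: add_ac mult_ac)
  finally show ?case .
qed

text \<open>Integration by parts moves one derivative onto \<open>q\<close> and passes to \<open>(a + 1, b + 1)\<close>; after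
  \<open>n\<close> steps only the \<open>n\<close>-th derivative of \<open>q\<close> is left, which is a constant. For
  \<open>degree q < n\<close> this is orthogonality, and for \<open>q = jacobi_poly n a b\<close> it gives the norm.\<close>

lemma jacobi_int_jacobi_poly_mult:
  assumes "a > -1" "b > -1" "degree q \<le> n"
  shows "jacobi_int a b (jacobi_poly n a b * q)
       = coeff q n / 2 ^ n * jacobi_int (a + real n) (b + real n) 1"
  using assms
proof (induction n arbitrary: a b q)
  case 0
  then obtain c where "q = [:c:]" by (auto elim: degree_eq_zeroE)
  then show ?case using jacobi_int_smult[of a b c 1] by simp
next
  case (Suc n)
  let ?P = "jacobi_poly n (a + 1) (b + 1)"
  have "degree (pderiv q) \<le> n"
    using Suc.prems by (simp add: degree_pderiv)
  then have IH: "jacobi_int (a + 1) (b + 1) (?P * pderiv q)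
      = coeff (pderiv q) n / 2 ^ n * jacobi_int (a + 1 + real n) (b + 1 + real n) 1"
    using Suc.IH[of "a + 1" "b + 1"] Suc.prems by simp
  have "jacobi_int a b (jacobi_poly (Suc n) a b * q)
      = - 1 / (2 * (real n + 1)) * jacobi_int a b (jacobi_shift (a + 1) (b + 1) ?P * q)"
    unfolding jacobi_poly.simps mult_smult_left jacobi_int_smult ..
  also have "\<dots> = 1 / (2 * (real n + 1)) * jacobi_int (a + 1) (b + 1) (?P * pderiv q)"
    using Suc.prems by (simp add: jacobi_int_by_parts)
  also have "\<dots> = coeff q (Suc n) / 2 ^ Suc n * jacobi_int (a + real (Suc n)) (b + real (Suc n)) 1"
  proof -
    have "1 / (2 * N) * (N * c / 2 ^ n * I) = c / 2 ^ Suc n * I" if "N \<noteq> 0" for N c I :: real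
      using that by simp
    from this[of "real (Suc n)"] show ?thesis
      unfolding IH coeff_pderiv by (simp add: add_ac)
  qed
  finally show ?case .
qed

definition jacobi_sqnorm :: "nat \<Rightarrow> real \<Rightarrow> real \<Rightarrow> real" where
  "jacobi_sqnorm n a b = jacobi_int a b (jacobi_poly n a b * jacobi_poly n a b)"

lemma jacobi_sqnorm_eq:
  assumes "a > -1" "b > -1"
  shows "jacobi_sqnorm n a b = jacobi_lead n a b / 2 ^ n * jacobi_int (a + real n) (b + real n) 1"
  unfolding jacobi_sqnorm_def jacobi_lead_def
  using jacobi_int_jacobi_poly_mult[OF assms degree_jacobi_poly] .

lemma jacobi_sqnorm_pos:
  assumes "a > -1" "b > -1"
  shows "jacobi_sqnorm n a b > 0"
  unfolding jacobi_sqnorm_eq[OF assms]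
  using assms by (intro mult_pos_pos divide_pos_pos jacobi_lead_pos jacobi_int_1_pos) auto

lemma jacobi_sqnorm_ratio:
  assumes "a > -1" "b > -1"
  shows "(2 * real n + a + b + 2) * (2 * real n + a + b + 3) * jacobi_sqnorm (Suc n) a b * jacobi_lead n a b
       = 2 * (real n + a + 1) * (real n + b + 1) * jacobi_sqnorm n a b * jacobi_lead (Suc n) a b"
proof -
  define I where "I = jacobi_int (a + real n) (b + real n) 1"
  define I' where "I' = jacobi_int (a + real n + 1) (b + real n + 1) 1"
  have I: "(2 * real n + a + b + 2) * (2 * real n + a + b + 3) * I'
      = 4 * (real n + a + 1) * (real n + b + 1) * I"
    using jacobi_int_1_step[of "a + real n" "b + real n"] assms
    by (simp add: I_def I'_def algebra_simps)
  have 1: "jacobi_sqnorm (Suc n) a b = jacobi_lead (Suc n) a b / (2 * 2 ^ n) * I'"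
    using jacobi_sqnorm_eq[OF assms, of "Suc n"] by (simp add: I'_def add_ac)
  have 2: "jacobi_sqnorm n a b = jacobi_lead n a b / 2 ^ n * I"
    using jacobi_sqnorm_eq[OF assms, of n] by (simp add: I_def)
  have "(2 * real n + a + b + 2) * (2 * real n + a + b + 3) * jacobi_sqnorm (Suc n) a b * jacobi_lead n a b
      = jacobi_lead (Suc n) a b * jacobi_lead n a b / (2 * 2 ^ n)
          * ((2 * real n + a + b + 2) * (2 * real n + a + b + 3) * I')"
    unfolding 1 by simp
  also have "\<dots> = 2 * (real n + a + 1) * (real n + b + 1) * jacobi_sqnorm n a b * jacobi_lead (Suc n) a b"
    unfolding I 2 by (simp add: field_simps)
  finally show ?thesis .
qed

section \<open>Orthonormal Jacobi polynomials and their recurrence\<close>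

definition jacobi_opoly :: "nat \<Rightarrow> real \<Rightarrow> real \<Rightarrow> real poly" where
  "jacobi_opoly n a b = smult (1 / sqrt (jacobi_sqnorm n a b)) (jacobi_poly n a b)"

lemma jacobi_p_eq: "jacobi_p a b n = poly (jacobi_opoly n a b)"
  by (rule ext) (simp add: jacobi_p_def jacobi_P_eq jacobi_opoly_def jacobi_sqnorm_def
      jacobi_int_def power2_eq_square)

definition jacobi_olead :: "nat \<Rightarrow> real \<Rightarrow> real \<Rightarrow> real" where
  "jacobi_olead n a b = coeff (jacobi_opoly n a b) n"

lemma degree_jacobi_opoly: "degree (jacobi_opoly n a b) \<le> n"
  unfolding jacobi_opoly_def using degree_smult_le degree_jacobi_poly order_trans by blast

lemma jacobi_olead_eq: "jacobi_olead n a b = jacobi_lead n a b / sqrt (jacobi_sqnorm n a b)"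
  by (simp add: jacobi_olead_def jacobi_opoly_def jacobi_lead_def)

lemma jacobi_olead_pos:
  assumes "a > -1" "b > -1"
  shows "jacobi_olead n a b > 0"
  using assms jacobi_sqnorm_pos[OF assms] jacobi_lead_pos[of a b n] by (simp add: jacobi_olead_eq)

lemma jacobi_int_opoly_mult:
  assumes "a > -1" "b > -1" "degree q \<le> n"
  shows "jacobi_int a b (jacobi_opoly n a b * q) = coeff q n / jacobi_olead n a b"
proof -
  define h where "h = jacobi_sqnorm n a b"
  have h: "h > 0" using jacobi_sqnorm_pos[OF assms(1,2)] by (simp add: h_def)
  have l: "jacobi_lead n a b > 0" using assms by (intro jacobi_lead_pos) simp
  have I: "jacobi_int (a + real n) (b + real n) 1 / 2 ^ n = h / jacobi_lead n a b"
    using jacobi_sqnorm_eq[OF assms(1,2), of n] l by (simp add: h_def)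
  have "jacobi_int a b (jacobi_opoly n a b * q)
      = 1 / sqrt h * (coeff q n * (jacobi_int (a + real n) (b + real n) 1 / 2 ^ n))"
    unfolding jacobi_opoly_def mult_smult_left jacobi_int_smult jacobi_int_jacobi_poly_mult[OF assms]
    by (simp add: h_def)
  also have "\<dots> = coeff q n * (h / sqrt h) / jacobi_lead n a b"
    unfolding I by simp
  also have "h / sqrt h = sqrt h" using h by (simp add: real_div_sqrt)
  finally show ?thesis by (simp add: jacobi_olead_eq h_def)
qed

lemma jacobi_opoly_orthonormal:
  assumes "a > -1" "b > -1"
  shows "jacobi_int a b (jacobi_opoly m a b * jacobi_opoly n a b) = (if m = n then 1 else 0)"
proof -
  have *: "jacobi_int a b (jacobi_opoly m a b * jacobi_opoly n a b) = (if m = n then 1 else 0)"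
    if "n \<le> m" for m n
  proof -
    have d: "degree (jacobi_opoly n a b) \<le> m" using degree_jacobi_opoly[of n a b] that by simp
    have "coeff (jacobi_opoly n a b) m / jacobi_olead m a b = (if m = n then 1 else 0)"
    proof (cases "m = n")
      case True
      then show ?thesis using jacobi_olead_pos[OF assms, of n] by (simp flip: jacobi_olead_def)
    next
      case False
      then have "degree (jacobi_opoly n a b) < m" using degree_jacobi_opoly[of n a b] that by simp
      then show ?thesis using False by (simp add: coeff_eq_0)
    qed
    with jacobi_int_opoly_mult[OF assms d] show ?thesis by simp
  qed
  show ?thesis
  proof (cases "n \<le> m")
    case False
    then show ?thesis using *[of m n] by (simp add: mult.commute)
  qed (rule *)
qed

lemma jacobi_a_nonneg:
  assumes "a > -1" "b > -1"
  shows "jacobi_a a b n \<ge> 0"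
  using assms unfolding jacobi_a_def by auto

text \<open>The coefficient of \<open>p\<^bsub>n+1\<^esub>\<close> in \<open>x p\<^sub>n\<close> has to be the quotient of the leading coefficients. Its
  square is rational in \<open>n\<close>, \<open>a\<close> and \<open>b\<close>; the case \<open>n = 0\<close> is separate because of the factor
  \<open>n + a + b + 1\<close>, which cancels against \<open>2 n + a + b + 1\<close> there.\<close>

lemma jacobi_a_eq:
  assumes ab: "a > -1" "b > -1"
  shows "jacobi_a a b n = jacobi_olead n a b / jacobi_olead (Suc n) a b"
proof (rule power2_eq_imp_eq)
  define h where "h = jacobi_sqnorm n a b"
  define h' where "h' = jacobi_sqnorm (Suc n) a b"
  define k where "k = jacobi_lead n a b"
  define k' where "k' = jacobi_lead (Suc n) a b"
  have pos: "h > 0" "h' > 0" "k > 0" "k' > 0"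
    using assms by (auto simp: h_def h'_def k_def k'_def intro!: jacobi_sqnorm_pos jacobi_lead_pos)
  define s where "s = a + b"
  have s: "s > -2" using ab by (simp add: s_def)
  have "(jacobi_olead n a b / jacobi_olead (Suc n) a b)\<^sup>2 = (k / k') * ((h' * k) / (h * k'))"
    using pos unfolding jacobi_olead_eq h_def[symmetric] h'_def[symmetric] k_def[symmetric] k'_def[symmetric]
    by (simp add: power_divide power_mult_distrib) (simp add: field_simps power2_eq_square)
  also have "(h' * k) / (h * k')
      = 2 * (real n + a + 1) * (real n + b + 1) / ((2 * real n + s + 2) * (2 * real n + s + 3))"
    using jacobi_sqnorm_ratio[OF ab, of n] pos s
    unfolding h_def[symmetric] h'_def[symmetric] k_def[symmetric] k'_def[symmetric]
    by (simp add: frac_eq_eq s_def mult_ac add_ac)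
  finally have R: "(jacobi_olead n a b / jacobi_olead (Suc n) a b)\<^sup>2 = (k / k') *
      (2 * (real n + a + 1) * (real n + b + 1) / ((2 * real n + s + 2) * (2 * real n + s + 3)))" .
  show "(jacobi_a a b n)\<^sup>2 = (jacobi_olead n a b / jacobi_olead (Suc n) a b)\<^sup>2"
  proof (cases "n = 0")
    case True
    have "(a + 1) * (b + 1) / (s + 3) \<ge> 0" using ab s by auto
    then have "(jacobi_a a b n)\<^sup>2 = 4 / (s + 2)\<^sup>2 * ((a + 1) * (b + 1) / (s + 3))"
      using True by (simp add: jacobi_a_def power_mult_distrib power_divide s_def add_ac)
    moreover have "k / k' = 2 / (s + 2)"
      using True by (simp add: k_def k'_def jacobi_lead_Suc s_def add_ac)
    ultimately show ?thesis unfolding R using True s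
      by (simp add: power2_eq_square) (simp add: algebra_simps)
  next
    case False
    then have n: "real n \<ge> 1" by simp
    let ?q = "(real n + 1) * (real n + a + 1) * (real n + b + 1) * (real n + s + 1) /
                 ((2 * real n + s + 1) * (2 * real n + s + 3))"
    have "?q \<ge> 0" using ab s n by auto
    then have "(jacobi_a a b n)\<^sup>2 = 4 / (2 * real n + s + 2)\<^sup>2 * ?q"
      using False by (simp add: jacobi_a_def power_mult_distrib power_divide s_def add_ac)
    moreover have "k / k' = 2 * (real n + 1) * (real n + s + 1) / ((2 * real n + s + 1) * (2 * real n + s + 2))"
      using jacobi_lead_ratio[of n a b] pos s n
      by (simp add: k_def k'_def s_def frac_eq_eq mult_ac add_ac)
    moreover have "4 / P\<^sup>2 * (A * B * C * D / (Q * R)) = (2 * A * D / (Q * P)) * (2 * B * C / (P * R))"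
      for A B C D P Q R :: real
      by (simp add: power2_eq_square mult_ac)
    ultimately show ?thesis unfolding R by (simp only:)
  qed
qed (use jacobi_a_nonneg[OF ab] jacobi_olead_pos[OF ab] in \<open>auto simp: less_imp_le\<close>)

lemma jacobi_opoly_sublead:
  assumes "a > -1" "b > -1"
  shows "coeff (jacobi_opoly (Suc n) a b) n
       = (real n + 1) * (a - b) / (2 * real n + a + b + 2) * jacobi_olead (Suc n) a b"
proof -
  have "2 * real n + a + b + 2 > 0" using assms by simp
  then have "coeff (jacobi_poly (Suc n) a b) n
      = (real n + 1) * (a - b) / (2 * real n + a + b + 2) * jacobi_lead (Suc n) a b"
    using jacobi_sublead[of a b n] assms by (simp add: field_simps)
  then show ?thesis by (simp add: jacobi_opoly_def jacobi_olead_eq del: jacobi_poly.simps)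
qed

text \<open>The formulas for \<open>jacobi_a\<close> and \<open>jacobi_b\<close> make the coefficients of \<open>x\<^bsup>n+1\<^esup>\<close> and \<open>x\<^sup>n\<close> agree, so
  the difference \<open>R\<close> of the two sides has degree less than \<open>n\<close>. By \<open>jacobi_int_opoly_mult\<close> it
  is orthogonal to all polynomials of degree less than \<open>n\<close>, hence to itself.\<close>

lemma jacobi_opoly_recurrence:
  assumes ab: "a > -1" "b > -1"
  shows "[:0, 1:] * jacobi_opoly n a b =
     (if n = 0 then 0 else smult (jacobi_a a b (n - 1)) (jacobi_opoly (n - 1) a b))
       + smult (jacobi_b a b n) (jacobi_opoly n a b) + smult (jacobi_a a b n) (jacobi_opoly (Suc n) a b)"
    (is "?x * _ = ?A + _ + _")
proof -
  let ?p = "\<lambda>n. jacobi_opoly n a b"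
  let ?l = "\<lambda>n. jacobi_olead n a b"
  define R where "R = ?x * ?p n - ?A - smult (jacobi_b a b n) (?p n) - smult (jacobi_a a b n) (?p (Suc n))"
  have l: "?l k > 0" for k by (rule jacobi_olead_pos[OF ab])
  have above: "coeff (?p k) i = 0" if "k < i" for k i
    using degree_jacobi_opoly[of k a b] that by (intro coeff_eq_0) simp
  have A_above: "coeff ?A i = 0" if "n \<le> i" for i
    using that by (auto intro: above)
  have R_above: "coeff R i = 0" if i: "n \<le> i" for i
  proof -
    consider "i = n" | "i = Suc n" | "Suc (Suc n) \<le> i"
      using i by linarith
    then show ?thesis
    proof cases
      case 1
      have "coeff (?x * ?p n) n = jacobi_b a b n * ?l n + jacobi_a a b n * coeff (?p (Suc n)) n"
      proof (cases n)
        case 0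
        have "jacobi_a a b n * coeff (?p (Suc n)) n = (a - b) / (a + b + 2) * ?l n"
          using 0 l[of "Suc n"] jacobi_opoly_sublead[OF ab, of n] by (simp add: jacobi_a_eq[OF ab])
        moreover have "jacobi_b a b n + (a - b) / (a + b + 2) = 0"
          using 0 by (simp add: jacobi_b_def flip: add_divide_distrib)
        ultimately have "jacobi_b a b n * ?l n + jacobi_a a b n * coeff (?p (Suc n)) n = 0"
          by (simp only: flip: distrib_right)
        then show ?thesis
          using 0 by simp
      next
        case (Suc m)
        have "real m + 1 > 0" by simp
        then have d: "2 * real m + a + b + 2 > 0" "2 * real m + a + b + 4 > 0" using ab by auto
        have "(real m + 1) * (a - b) / (2 * real m + a + b + 2)
           = (b\<^sup>2 - a\<^sup>2) / ((2 * real m + a + b + 2) * (2 * real m + a + b + 4))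
             + (real m + 2) * (a - b) / (2 * real m + a + b + 4)"
          using d by (simp add: divide_simps) (simp add: algebra_simps power2_eq_square)
        moreover have "coeff (?x * ?p n) n = (real m + 1) * (a - b) / (2 * real m + a + b + 2) * ?l n"
          using Suc jacobi_opoly_sublead[OF ab, of m] by (simp add: coeff_pCons)
        moreover have "jacobi_b a b n = (b\<^sup>2 - a\<^sup>2) / ((2 * real m + a + b + 2) * (2 * real m + a + b + 4))"
          using Suc by (simp add: jacobi_b_def add_ac)
        moreover have "jacobi_a a b n * coeff (?p (Suc n)) n
            = (real m + 2) * (a - b) / (2 * real m + a + b + 4) * ?l n"
          using Suc l[of "Suc n"] jacobi_opoly_sublead[OF ab, of n]
          by (simp add: jacobi_a_eq[OF ab] add_ac)
        ultimately show ?thesis by (simp add: distrib_right)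
      qed
      then show ?thesis
        using 1 A_above[of n] by (simp add: R_def jacobi_olead_def)
    next
      case 2
      then show ?thesis
        using A_above[of "Suc n"] l[of "Suc n"] above[of n "Suc n"]
        by (simp add: R_def jacobi_a_eq[OF ab]) (simp add: jacobi_olead_def)
    next
      case 3
      then obtain j where "i = Suc j" "Suc n \<le> j" by (cases i) auto
      then show ?thesis
        using A_above[of i] by (simp add: R_def above)
    qed
  qed
  have "jacobi_int a b (R * q) = 0" if q: "degree q < n" for q
  proof -
    have x: "coeff (?x * q) n = coeff q (n - 1)" "degree (?x * q) \<le> n"
      using q by (cases n; auto simp: coeff_pCons degree_mult_le order_trans[OF degree_pCons_le])+
    have "jacobi_int a b (?p n * q) = 0" "jacobi_int a b (?p (Suc n) * q) = 0"
      using q by (simp_all add: jacobi_int_opoly_mult[OF ab] coeff_eq_0)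
    moreover have "jacobi_int a b (?x * ?p n * q) = coeff q (n - 1) / ?l n"
    proof -
      have "?x * ?p n * q = ?p n * (?x * q)" by (simp only: mult_ac)
      then show ?thesis using jacobi_int_opoly_mult[OF ab x(2)] x(1) by simp
    qed
    moreover have "jacobi_int a b (?A * q) = coeff q (n - 1) / ?l n"
    proof -
      have n: "n = Suc (n - 1)" using q by simp
      have "jacobi_int a b (?A * q) = jacobi_a a b (n - 1) * (coeff q (n - 1) / ?l (n - 1))"
        using q by (auto simp: jacobi_int_smult jacobi_int_opoly_mult[OF ab])
      moreover have "jacobi_a a b (n - 1) = ?l (n - 1) / ?l n"
        using jacobi_a_eq[OF ab, of "n - 1"] n by simp
      ultimately show ?thesis using l[of "n - 1"] by simp
    qed
    ultimately show ?thesis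
      by (simp only: R_def left_diff_distrib jacobi_int_diff[OF ab] mult_smult_left jacobi_int_smult)
  qed
  moreover have "degree R < n" if "R \<noteq> 0"
    using R_above that by (metis leading_coeff_0_iff not_le)
  ultimately have "R = 0"
    using jacobi_int_square_eq_0D[OF ab, of R] by blast
  then show ?thesis by (simp add: R_def algebra_simps)
qed

section \<open>Elementary inequalities behind the maximal theorem\<close>

text \<open>A maximal inequality may be proved for each selection \<open>\<kappa>\<close> of indices separately: suprema are
  limits along suitable selections, and only finitely many of them enter the sum.\<close>

lemma sum_SUP_le_of_choice:
  fixes h :: "'n \<Rightarrow> 'k \<Rightarrow> real"
  assumes A: "finite A" and T: "T \<noteq> {}"
    and choice: "\<And>\<kappa>. (\<forall>n. \<kappa> n \<in> T) \<Longrightarrow> (\<Sum>n\<in>A. (h n (\<kappa> n))\<^sup>2) \<le> C"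
  shows "n \<in> A \<Longrightarrow> bdd_above ((\<lambda>k. \<bar>h n k\<bar>) ` T)"
    and "(\<Sum>n\<in>A. (SUP k\<in>T. \<bar>h n k\<bar>)\<^sup>2) \<le> C"
proof -
  have bdd: "bdd_above ((\<lambda>k. \<bar>h n k\<bar>) ` T)" if "n \<in> A" for n
  proof (rule bdd_aboveI2)
    fix k assume "k \<in> T"
    then have "(\<Sum>n\<in>A. (h n k)\<^sup>2) \<le> C" by (intro choice) simp
    moreover have "(h n k)\<^sup>2 \<le> (\<Sum>n\<in>A. (h n k)\<^sup>2)"
      using that A by (intro member_le_sum) auto
    ultimately have "\<bar>h n k\<bar>\<^sup>2 \<le> C" by simp
    then show "\<bar>h n k\<bar> \<le> sqrt C" by (rule real_le_rsqrt)
  qed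
  then show "n \<in> A \<Longrightarrow> bdd_above ((\<lambda>k. \<bar>h n k\<bar>) ` T)" .
  define S where "S n = (SUP k\<in>T. \<bar>h n k\<bar>)" for n
  have "\<exists>k\<in>T. n \<in> A \<longrightarrow> S n - 1 / real (Suc i) < \<bar>h n k\<bar>" for n i
  proof (cases "n \<in> A")
    case True
    have "S n - 1 / real (Suc i) < S n" by simp
    then show ?thesis
      unfolding S_def using less_cSUP_iff[OF T bdd[OF True]] by auto
  qed (use T in auto)
  then have "\<forall>i n. \<exists>k. k \<in> T \<and> (n \<in> A \<longrightarrow> S n - 1 / real (Suc i) < \<bar>h n k\<bar>)"
    by blast
  then obtain \<kappa> where \<kappa>: "\<And>i n. \<kappa> i n \<in> T"
      "\<And>i n. n \<in> A \<Longrightarrow> S n - 1 / real (Suc i) < \<bar>h n (\<kappa> i n)\<bar>"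
    by metis
  have lim: "(\<lambda>i. \<bar>h n (\<kappa> i n)\<bar>) \<longlonglongrightarrow> S n" if "n \<in> A" for n
  proof (rule tendsto_sandwich)
    show "(\<lambda>i. S n - 1 / real (Suc i)) \<longlonglongrightarrow> S n"
      using tendsto_diff[OF tendsto_const LIMSEQ_Suc[OF lim_1_over_n], of "S n"] by simp
    show "\<forall>\<^sub>F i in sequentially. S n - 1 / real (Suc i) \<le> \<bar>h n (\<kappa> i n)\<bar>"
      using \<kappa>(2)[OF that] by (intro always_eventually allI less_imp_le)
    show "\<forall>\<^sub>F i in sequentially. \<bar>h n (\<kappa> i n)\<bar> \<le> S n"
      unfolding S_def using \<kappa>(1) by (intro always_eventually allI cSUP_upper bdd that)
  qed simp
  have "(\<lambda>i. \<Sum>n\<in>A. \<bar>h n (\<kappa> i n)\<bar>\<^sup>2) \<longlonglongrightarrow> (\<Sum>n\<in>A. (S n)\<^sup>2)"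
    by (intro tendsto_sum tendsto_power lim)
  then show "(\<Sum>n\<in>A. (SUP k\<in>T. \<bar>h n k\<bar>)\<^sup>2) \<le> C"
    unfolding S_def[symmetric]
    by (rule LIMSEQ_le_const2) (use choice[of "\<kappa> _"] \<kappa>(1) in auto)
qed

definition power_mean :: "nat \<Rightarrow> real \<Rightarrow> real" where
  "power_mean k y = (\<Sum>i\<le>k. y ^ i) / (real k + 1)"

lemma continuous_on_power_mean [continuous_intros]:
  "continuous_on S g \<Longrightarrow> continuous_on S (\<lambda>x. power_mean k (g x))"
  unfolding power_mean_def by (intro continuous_intros) auto

lemma power_mean_bounds:
  assumes "0 \<le> y" "y \<le> 1"
  shows "0 \<le> power_mean k y" "power_mean k y \<le> 1"
proof -
  show "0 \<le> power_mean k y"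
    unfolding power_mean_def using assms by (intro divide_nonneg_nonneg sum_nonneg) auto
  have "(\<Sum>i\<le>k. y ^ i) \<le> (\<Sum>i\<le>k. 1)"
    using assms by (intro sum_mono power_le_one) auto
  then show "power_mean k y \<le> 1" by (simp add: power_mean_def)
qed

text \<open>If \<open>l \<le> k\<close>, then for each \<open>j \<le> l\<close> the indices \<open>i + j\<close> lie in \<open>{..2 * k + 1}\<close>, so the sum
  over \<open>i\<close> is bounded by the longer sum and averaging over \<open>j\<close> does not increase it. Having both
  terms on the right makes the bound symmetric in \<open>k\<close> and \<open>l\<close>.\<close>

lemma double_mean_le:
  fixes c :: "nat \<Rightarrow> real"
  assumes c: "\<And>i. c i \<ge> 0"
  shows "(\<Sum>i\<le>k. \<Sum>j\<le>l. c (i + j)) / ((real k + 1) * (real l + 1))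
    \<le> (\<Sum>i\<le>2*k+1. c i) / (real k + 1) + (\<Sum>i\<le>2*l+1. c i) / (real l + 1)"
proof -
  have *: "(\<Sum>i\<le>k. \<Sum>j\<le>l. c (i + j)) / ((real k + 1) * (real l + 1))
    \<le> (\<Sum>i\<le>2*k+1. c i) / (real k + 1)" if "l \<le> k" for k l
  proof -
    have "(\<Sum>i\<le>k. c (i + j)) \<le> (\<Sum>i\<le>2*k+1. c i)" if "j \<le> l" for j
    proof -
      have "(\<Sum>i\<le>k. c (i + j)) = sum c ((\<lambda>i. i + j) ` {..k})"
        by (subst sum.reindex) (auto simp: inj_on_def)
      also have "\<dots> \<le> (\<Sum>i\<le>2*k+1. c i)"
        using c that \<open>l \<le> k\<close> by (intro sum_mono2) auto
      finally show ?thesis .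
    qed
    then have "(\<Sum>j\<le>l. \<Sum>i\<le>k. c (i + j)) \<le> (\<Sum>j\<le>l. \<Sum>i\<le>2*k+1. c i)"
      by (intro sum_mono) auto
    then have "(\<Sum>i\<le>k. \<Sum>j\<le>l. c (i + j)) \<le> (real l + 1) * (\<Sum>i\<le>2*k+1. c i)"
      by (subst sum.swap) (simp add: add.commute)
    then have "(\<Sum>i\<le>k. \<Sum>j\<le>l. c (i + j)) / ((real k + 1) * (real l + 1))
      \<le> ((real l + 1) * (\<Sum>i\<le>2*k+1. c i)) / ((real k + 1) * (real l + 1))"
      by (rule divide_right_mono) simp
    also have "((real l + 1) * (\<Sum>i\<le>2*k+1. c i)) / ((real k + 1) * (real l + 1))
      = (\<Sum>i\<le>2*k+1. c i) / (real k + 1)"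
      by (simp add: add_nonneg_eq_0_iff)
    finally show ?thesis .
  qed
  have nn: "0 \<le> (\<Sum>i\<le>2*k+1. c i) / (real k + 1)" for k
    using c by (intro divide_nonneg_nonneg sum_nonneg) auto
  show ?thesis
  proof (cases "l \<le> k")
    case True
    then show ?thesis using *[OF True] nn[of l] by linarith
  next
    case False
    have "(\<Sum>i\<le>k. \<Sum>j\<le>l. c (i + j)) = (\<Sum>i\<le>l. \<Sum>j\<le>k. c (i + j))"
      by (subst sum.swap) (simp add: add.commute)
    then show ?thesis using *[of k l] False nn[of k] by (simp add: mult.commute)
  qed
qed

text \<open>Summation by parts.\<close>

lemma power_minus_power_mean:
  "y ^ k - power_mean k y = (\<Sum>j\<in>{1..k}. real j * (y ^ j - y ^ (j - 1))) / (real k + 1)"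
proof -
  have "(\<Sum>j\<in>{1..k}. real j * (y ^ j - y ^ (j - 1))) = (real k + 1) * y ^ k - (\<Sum>i\<le>k. y ^ i)"
    by (induction k) (simp_all add: algebra_simps)
  then show ?thesis by (simp add: power_mean_def diff_divide_distrib)
qed

text \<open>With \<open>z = y\<^sup>2\<close> one has \<open>1 - y \<le> 1 - z\<close>, which reduces the claim to the geometric-type sum
  \<open>(1 - z)\<^sup>2 \<Sum>\<^sub>j j z\<^bsup>j-1\<^esup> \<le> 1\<close>.\<close>

lemma square_function_sum_le:
  fixes y :: real
  assumes "0 \<le> y" "y \<le> 1"
  shows "(\<Sum>j\<in>{1..K}. real j * (y ^ j - y ^ (j - 1))\<^sup>2) \<le> 1"
proof -
  define z where "z = y\<^sup>2"
  have z: "0 \<le> z" "z \<le> 1" using assms by (auto simp: z_def power_le_one)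
  have "(1 - z)\<^sup>2 * (\<Sum>j\<in>{1..K}. real j * z ^ (j - 1)) = 1 - z ^ K - real K * z ^ K * (1 - z)"
    by (induction K) (simp_all add: algebra_simps power2_eq_square)
  also have "\<dots> \<le> 1"
  proof -
    have "0 \<le> z ^ K" "0 \<le> real K * z ^ K * (1 - z)" using z by auto
    then show ?thesis by linarith
  qed
  finally have *: "(\<Sum>j\<in>{1..K}. real j * ((1 - z)\<^sup>2 * z ^ (j - 1))) \<le> 1"
    by (simp add: sum_distrib_left mult_ac)
  have "real j * (y ^ j - y ^ (j - 1))\<^sup>2 \<le> real j * ((1 - z)\<^sup>2 * z ^ (j - 1))" if "j \<in> {1..K}" for j
  proof -
    obtain i where j: "j = Suc i" using \<open>j \<in> {1..K}\<close> by (cases j) auto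
    have "(1 - y)\<^sup>2 \<le> (1 - z)\<^sup>2"
      using assms by (intro power_mono) (auto simp: z_def power2_eq_square mult_left_le)
    moreover have "(y ^ j - y ^ (j - 1))\<^sup>2 = (1 - y)\<^sup>2 * z ^ (j - 1)"
      by (simp add: j z_def power2_eq_square power_mult_distrib algebra_simps)
    ultimately show ?thesis using z
      by (auto intro!: mult_left_mono mult_right_mono)
  qed
  then show ?thesis using * by (meson order_trans sum_mono)
qed

section \<open>Measures with a nonnegative Jacobi matrix\<close>

text \<open>The hypotheses say that \<open>p\<close> is an orthonormal system in \<open>L\<^sup>2(M)\<close> in which multiplication by
  \<open>x\<close> is given by the tridiagonal matrix with diagonal \<open>b\<close> and off-diagonal \<open>a\<close>.\<close>

locale jacobi_matrix_measure =
  fixes M :: "real measure" and p :: "nat \<Rightarrow> real \<Rightarrow> real" and a b :: "nat \<Rightarrow> real"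
  assumes finite_M: "finite_measure M"
    and sets_M: "sets M = sets borel"
    and AE_M: "AE x in M. x \<in> {-1..1}"
    and cont_p: "continuous_on UNIV (p n)"
    and ortho: "(\<integral>x. p m x * p n x \<partial>M) = (if m = n then 1 else 0)"
    and recurrence:
      "x * p n x = (if n = 0 then 0 else a (n - 1) * p (n - 1) x) + b n * p n x + a n * p (Suc n) x"
    and a_nonneg: "a n \<ge> 0"
begin

lemma continuous_p [continuous_intros]: "continuous_on S (p n)"
  using cont_p by (rule continuous_on_subset) simp

lemma integrable_cont:
  fixes g :: "real \<Rightarrow> real"
  shows "continuous_on UNIV g \<Longrightarrow> integrable M g"
  by (rule integrable_continuous_on_finite_measure[OF finite_M sets_M AE_M])

lemma integral_mono_cont:
  fixes g h :: "real \<Rightarrow> real"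
  assumes "continuous_on UNIV g" "continuous_on UNIV h" "\<And>x. x \<in> {-1..1} \<Longrightarrow> g x \<le> h x"
  shows "(\<integral>x. g x \<partial>M) \<le> (\<integral>x. h x \<partial>M)"
  by (intro integral_mono_AE integrable_cont assms) (rule eventually_mono[OF AE_M], rule assms(3))

lemma integral_sum_cont:
  fixes g :: "'i \<Rightarrow> real \<Rightarrow> real"
  assumes "\<And>i. i \<in> A \<Longrightarrow> continuous_on UNIV (g i)"
  shows "(\<integral>x. (\<Sum>i\<in>A. g i x) \<partial>M) = (\<Sum>i\<in>A. \<integral>x. g i x \<partial>M)"
  using assms by (intro Bochner_Integration.integral_sum integrable_cont)

text \<open>The integral of \<open>(F - c G)\<^sup>2\<close> is a nonnegative quadratic polynomial in \<open>c\<close>.\<close>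

lemma Cauchy_Schwarz_integral:
  fixes F G :: "real \<Rightarrow> real"
  assumes F: "continuous_on UNIV F" and G: "continuous_on UNIV G"
  shows "(\<integral>x. F x * G x \<partial>M)\<^sup>2 \<le> (\<integral>x. (F x)\<^sup>2 \<partial>M) * (\<integral>x. (G x)\<^sup>2 \<partial>M)"
proof -
  define A where "A = (\<integral>x. (F x)\<^sup>2 \<partial>M)"
  define B where "B = (\<integral>x. F x * G x \<partial>M)"
  define C where "C = (\<integral>x. (G x)\<^sup>2 \<partial>M)"
  have int: "integrable M (\<lambda>x. (F x)\<^sup>2)" "integrable M (\<lambda>x. F x * G x)" "integrable M (\<lambda>x. (G x)\<^sup>2)"
    using F G by (auto intro!: integrable_cont continuous_intros)
  have A: "A \<ge> 0" and C: "C \<ge> 0" by (simp_all add: A_def C_def)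
  have *: "0 \<le> A - 2 * c * B + c\<^sup>2 * C" for c
  proof -
    have "0 \<le> (\<integral>x. (F x - c * G x)\<^sup>2 \<partial>M)" by simp
    also have "(\<lambda>x. (F x - c * G x)\<^sup>2) = (\<lambda>x. (F x)\<^sup>2 - 2 * c * (F x * G x) + c\<^sup>2 * (G x)\<^sup>2)"
      by (simp add: fun_eq_iff power2_eq_square algebra_simps)
    also have "(\<integral>x. (F x)\<^sup>2 - 2 * c * (F x * G x) + c\<^sup>2 * (G x)\<^sup>2 \<partial>M) = A - 2 * c * B + c\<^sup>2 * C"
      unfolding A_def B_def C_def by (simp add: int)
    finally show ?thesis .
  qed
  have "B\<^sup>2 \<le> A * C"
  proof (cases "C = 0")
    case True
    have "B = 0"
    proof (rule ccontr)
      assume "B \<noteq> 0"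
      then show False using *[of "(A + 1) / (2 * B)"] True A by simp
    qed
    then show ?thesis using True by simp
  next
    case False
    with C have "C > 0" by simp
    have "0 \<le> A - 2 * (B / C) * B + (B / C)\<^sup>2 * C" by (rule *)
    also have "\<dots> = A - B\<^sup>2 / C"
      using \<open>C > 0\<close> by (simp add: power2_eq_square field_simps)
    finally show ?thesis using \<open>C > 0\<close> by (simp add: field_simps)
  qed
  then show ?thesis by (simp add: A_def B_def C_def)
qed

lemma integral_sum_p_mult:
  assumes "continuous_on UNIV F"
  shows "(\<integral>x. (\<Sum>n\<in>A. c n * p n x) * F x \<partial>M) = (\<Sum>n\<in>A. c n * (\<integral>x. p n x * F x \<partial>M))"
  unfolding sum_distrib_right
  by (subst integral_sum_cont) (use assms in \<open>auto intro!: continuous_intros simp: mult.assoc\<close>)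

lemma integral_sum_p_mult_p:
  assumes "finite A"
  shows "(\<integral>x. (\<Sum>n\<in>A. c n * p n x) * p m x \<partial>M) = (if m \<in> A then c m else 0)"
  using assms by (subst integral_sum_p_mult)
    (auto simp: ortho continuous_p if_distrib[of "(*) _"] sum.delta cong: if_cong)

lemma integral_sum_p_sq:
  assumes "finite A"
  shows "(\<integral>x. (\<Sum>n\<in>A. c n * p n x)\<^sup>2 \<partial>M) = (\<Sum>n\<in>A. (c n)\<^sup>2)"
  unfolding power2_eq_square
  by (subst integral_sum_p_mult)
     (use assms in \<open>auto intro!: continuous_intros sum.cong simp: integral_sum_p_mult_p mult.commute[of "p _ _"]\<close>)

lemma Bessel_inequality:
  assumes F: "continuous_on UNIV F"
  shows "(\<Sum>n<N. (\<integral>x. p n x * F x \<partial>M)\<^sup>2) \<le> (\<integral>x. (F x)\<^sup>2 \<partial>M)"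
proof -
  define c where "c n = (\<integral>x. p n x * F x \<partial>M)" for n
  define S where "S x = (\<Sum>n<N. c n * p n x)" for x
  have S: "continuous_on UNIV S" unfolding S_def by (intro continuous_intros)
  have 1: "(\<integral>x. S x * F x \<partial>M) = (\<Sum>n<N. (c n)\<^sup>2)"
    unfolding S_def by (subst integral_sum_p_mult[OF F]) (simp add: c_def power2_eq_square)
  have 2: "(\<integral>x. (S x)\<^sup>2 \<partial>M) = (\<Sum>n<N. (c n)\<^sup>2)"
    unfolding S_def by (rule integral_sum_p_sq) simp
  define s where "s = (\<Sum>n<N. (c n)\<^sup>2)"
  have "s\<^sup>2 \<le> s * (\<integral>x. (F x)\<^sup>2 \<partial>M)"
    using Cauchy_Schwarz_integral[OF S F] unfolding 1 2 s_def .
  moreover have "s \<ge> 0" by (simp add: s_def sum_nonneg)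
  ultimately have "s \<le> (\<integral>x. (F x)\<^sup>2 \<partial>M)"
    by (cases "s = 0") (auto simp: power2_eq_square)
  then show ?thesis by (simp add: s_def c_def)
qed

lemma integral_x_p_mult:
  assumes F: "continuous_on UNIV F"
  shows "(\<integral>x. x * p n x * F x \<partial>M) =
     (if n = 0 then 0 else a (n - 1) * (\<integral>x. p (n - 1) x * F x \<partial>M))
       + b n * (\<integral>x. p n x * F x \<partial>M) + a n * (\<integral>x. p (Suc n) x * F x \<partial>M)"
proof -
  have int: "integrable M (\<lambda>x. p k x * F x)" for k
    using F by (intro integrable_cont continuous_intros)
  show ?thesis
    unfolding recurrence by (simp add: int distrib_right mult.assoc)
qed

lemma a_eq: "a n = (\<integral>x. x * p n x * p (Suc n) x \<partial>M)"
  by (subst integral_x_p_mult) (auto simp: ortho continuous_p)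

lemma b_eq: "b n = (\<integral>x. x * p n x * p n x \<partial>M)"
  by (subst integral_x_p_mult) (auto simp: ortho continuous_p)

lemma sqnorm_p: "(\<integral>x. (p n x)\<^sup>2 \<partial>M) = 1"
  using ortho[of n n] by (simp add: power2_eq_square)

lemma b_ge: "b n \<ge> -1"
proof -
  have "(\<integral>x. - ((p n x)\<^sup>2) \<partial>M) \<le> (\<integral>x. x * p n x * p n x \<partial>M)"
  proof (rule integral_mono_cont)
    fix x :: real assume "x \<in> {-1..1}"
    then have "-1 * (p n x)\<^sup>2 \<le> x * (p n x)\<^sup>2" by (intro mult_right_mono) auto
    then show "- ((p n x)\<^sup>2) \<le> x * p n x * p n x" by (simp add: power2_eq_square mult.assoc)
  qed (auto intro!: continuous_intros)
  then show ?thesis by (simp add: sqnorm_p flip: b_eq)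
qed

lemma a_le_1: "a n \<le> 1"
proof -
  have "(a n)\<^sup>2 \<le> (\<integral>x. (x * p n x)\<^sup>2 \<partial>M) * (\<integral>x. (p (Suc n) x)\<^sup>2 \<partial>M)"
    unfolding a_eq by (intro Cauchy_Schwarz_integral continuous_intros)
  also have "(\<integral>x. (x * p n x)\<^sup>2 \<partial>M) \<le> (\<integral>x. (p n x)\<^sup>2 \<partial>M)"
  proof (rule integral_mono_cont)
    fix x :: real assume "x \<in> {-1..1}"
    then have "x\<^sup>2 \<le> 1" by (simp add: abs_le_iff flip: abs_le_square_iff[of x 1, simplified])
    then show "(x * p n x)\<^sup>2 \<le> (p n x)\<^sup>2"
      using mult_right_mono[of "x\<^sup>2" 1 "(p n x)\<^sup>2"] by (simp add: power_mult_distrib)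
  qed (auto intro!: continuous_intros)
  finally show ?thesis by (simp add: sqnorm_p power_le_one_iff abs_square_le_1)
qed

section \<open>A maximal inequality for powers\<close>

text \<open>Multiplication by \<open>y\<close> corresponds to the matrix \<open>(I + J) / 2\<close>, which has nonnegative entries and
  spectrum in \<open>[0, 1]\<close>.\<close>

definition y :: "real \<Rightarrow> real" where "y x = (1 + x) / 2"

lemma continuous_y [continuous_intros]: "continuous_on S y"
  unfolding y_def[abs_def] by (intro continuous_intros) auto

lemma y_bounds: "x \<in> {-1..1} \<Longrightarrow> 0 \<le> y x" "x \<in> {-1..1} \<Longrightarrow> y x \<le> 1"
  by (simp_all add: y_def)

text \<open>Multiplication by \<open>y\<close> turns \<open>p n\<close> into a combination of \<open>p (n - 1)\<close>, \<open>p n\<close> and \<open>p (Suc n)\<close> with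
  the nonnegative coefficients \<open>a (n - 1) / 2\<close>, \<open>(1 + b n) / 2\<close> and \<open>a n / 2\<close>.\<close>

lemma integral_power_p_p_nonneg: "(\<integral>x. y x ^ j * p n x * p m x \<partial>M) \<ge> 0"
proof (induction j arbitrary: n)
  case 0
  show ?case by (simp add: ortho)
next
  case (Suc j)
  let ?F = "\<lambda>x. y x ^ j * p m x"
  have F: "continuous_on UNIV ?F" by (intro continuous_intros)
  have eq: "(\<integral>x. p k x * ?F x \<partial>M) = (\<integral>x. y x ^ j * p k x * p m x \<partial>M)" for k
    by (simp add: mult_ac)
  have int: "integrable M (\<lambda>x. p n x * ?F x)" "integrable M (\<lambda>x. x * p n x * ?F x)"
    using F by (auto intro!: integrable_cont continuous_intros)
  have "(\<integral>x. y x ^ Suc j * p n x * p m x \<partial>M) = (\<integral>x. (1/2) * (p n x * ?F x) + (1/2) * (x * p n x * ?F x) \<partial>M)"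
    by (rule Bochner_Integration.integral_cong) (auto simp: y_def field_simps)
  also have "\<dots> = ((\<integral>x. p n x * ?F x \<partial>M) + (\<integral>x. x * p n x * ?F x \<partial>M)) / 2"
    using int by (subst Bochner_Integration.integral_add) auto
  also have "\<dots> = ((if n = 0 then 0 else a (n - 1) * (\<integral>x. p (n - 1) x * ?F x \<partial>M))
       + (1 + b n) * (\<integral>x. p n x * ?F x \<partial>M) + a n * (\<integral>x. p (Suc n) x * ?F x \<partial>M)) / 2"
    unfolding integral_x_p_mult[OF F] by (simp add: algebra_simps)
  also have "\<dots> \<ge> 0"
    unfolding eq using Suc a_nonneg b_ge[of n] by (auto intro!: add_nonneg_nonneg mult_nonneg_nonneg)
  finally show ?case .
qed

text \<open>The adjoint of the linearised maximal operator \<open>F \<mapsto> (\<integral>power_mean (k n) (y x) * p n x * F x dM)\<^sub>n\<close>,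
  applied to \<open>g\<close>.\<close>

definition mean_sum :: "nat \<Rightarrow> (nat \<Rightarrow> nat) \<Rightarrow> (nat \<Rightarrow> real) \<Rightarrow> real \<Rightarrow> real" where
  "mean_sum N k g x = (\<Sum>n<N. g n * (power_mean (k n) (y x) * p n x))"

lemma continuous_mean_sum [continuous_intros]: "continuous_on S (mean_sum N k g)"
  unfolding mean_sum_def[abs_def] by (intro continuous_intros)

lemma integral_mean_mean:
  "(\<integral>x. (power_mean k (y x) * p n x) * (power_mean l (y x) * p m x) \<partial>M)
    = (\<Sum>i\<le>k. \<Sum>j\<le>l. \<integral>x. y x ^ (i + j) * p n x * p m x \<partial>M) / ((real k + 1) * (real l + 1))"
proof -
  have "(\<integral>x. (power_mean k (y x) * p n x) * (power_mean l (y x) * p m x) \<partial>M)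
      = (\<integral>x. (\<Sum>i\<le>k. \<Sum>j\<le>l. y x ^ (i + j) * p n x * p m x) / ((real k + 1) * (real l + 1)) \<partial>M)"
    by (simp add: power_mean_def sum_product power_add sum_distrib_right sum_distrib_left mult_ac)
  then show ?thesis
    by (simp add: integral_sum_cont continuous_on_sum continuous_on_mult continuous_on_power
        continuous_y continuous_p)
qed

lemma integral_mean_mean_nonneg:
  "(\<integral>x. (power_mean k (y x) * p n x) * (power_mean l (y x) * p m x) \<partial>M) \<ge> 0"
  unfolding integral_mean_mean
  by (intro divide_nonneg_nonneg sum_nonneg integral_power_p_p_nonneg) auto

text \<open>The estimate \<open>double_mean_le\<close> for the moments of \<open>p n * p m\<close>, which are nonnegative. The mean of
  index \<open>2 * k + 1\<close> has twice as many terms as that of index \<open>k\<close>, hence the factor \<open>2\<close>.\<close>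

lemma integral_mean_mean_le:
  "(\<integral>x. (power_mean k (y x) * p n x) * (power_mean l (y x) * p m x) \<partial>M)
    \<le> 2 * (\<integral>x. (power_mean (2*k+1) (y x) * p n x) * p m x \<partial>M)
      + 2 * (\<integral>x. p n x * (power_mean (2*l+1) (y x) * p m x) \<partial>M)"
proof -
  define c where "c i = (\<integral>x. y x ^ i * p n x * p m x \<partial>M)" for i
  have mean: "(\<integral>x. power_mean k (y x) * (p n x * p m x) \<partial>M) = (\<Sum>i\<le>k. c i) / (real k + 1)" for k
  proof -
    have "(\<integral>x. power_mean k (y x) * (p n x * p m x) \<partial>M)
        = (\<integral>x. (\<Sum>i\<le>k. y x ^ i * p n x * p m x) / (real k + 1) \<partial>M)"
      by (simp add: power_mean_def sum_distrib_right mult.assoc)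
    also have "\<dots> = (\<integral>x. (\<Sum>i\<le>k. y x ^ i * p n x * p m x) \<partial>M) / (real k + 1)"
      by simp
    also have "\<dots> = (\<Sum>i\<le>k. c i) / (real k + 1)"
      unfolding c_def by (subst integral_sum_cont) (auto intro!: continuous_intros)
    finally show ?thesis .
  qed
  have "(\<integral>x. (power_mean k (y x) * p n x) * (power_mean l (y x) * p m x) \<partial>M)
      = (\<Sum>i\<le>k. \<Sum>j\<le>l. c (i + j)) / ((real k + 1) * (real l + 1))"
    by (simp add: integral_mean_mean c_def)
  also have "\<dots> \<le> (\<Sum>i\<le>2*k+1. c i) / (real k + 1) + (\<Sum>i\<le>2*l+1. c i) / (real l + 1)"
    by (rule double_mean_le) (simp add: c_def integral_power_p_p_nonneg)
  also have "\<dots> = 2 * (\<integral>x. power_mean (2*k+1) (y x) * (p n x * p m x) \<partial>M)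
      + 2 * (\<integral>x. power_mean (2*l+1) (y x) * (p n x * p m x) \<partial>M)"
  proof -
    have half: "X / (real k + 1) = 2 * (X / (real (2 * k + 1) + 1))" for X k
    proof -
      have *: "real (2 * k + 1) + 1 = 2 * (real k + 1)" by simp
      have "X / r = 2 * (X / (2 * r))" for r :: real by simp
      from this[of "real k + 1"] show ?thesis by (simp only: *)
    qed
    show ?thesis
      unfolding mean half[of "\<Sum>i\<le>2*k+1. c i" k] half[of "\<Sum>i\<le>2*l+1. c i" l] ..
  qed
  finally show ?thesis by (simp add: mult_ac)
qed

lemma integral_mean_sum_mult:
  assumes "continuous_on UNIV F"
  shows "(\<integral>x. mean_sum N k g x * F x \<partial>M) = (\<Sum>n<N. g n * (\<integral>x. (power_mean (k n) (y x) * p n x) * F x \<partial>M))"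
  unfolding mean_sum_def sum_distrib_right
  by (subst integral_sum_cont) (use assms in \<open>auto intro!: continuous_intros simp: mult.assoc\<close>)

lemma integral_mean_sum_sq:
  "(\<integral>x. (mean_sum N k g x)\<^sup>2 \<partial>M) =
    (\<Sum>n<N. \<Sum>m<N. g n * g m * (\<integral>x. (power_mean (k n) (y x) * p n x) * (power_mean (k m) (y x) * p m x) \<partial>M))"
proof -
  have "(\<integral>x. (power_mean (k n) (y x) * p n x) * mean_sum N k g x \<partial>M)
      = (\<Sum>m<N. g m * (\<integral>x. (power_mean (k n) (y x) * p n x) * (power_mean (k m) (y x) * p m x) \<partial>M))" for n
    using integral_mean_sum_mult[of "\<lambda>x. power_mean (k n) (y x) * p n x" N k g]
    by (simp add: continuous_intros mult.commute)
  then show ?thesis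
    unfolding power2_eq_square
    by (subst integral_mean_sum_mult) (auto intro!: continuous_intros simp: sum_distrib_left mult.assoc)
qed

lemma integral_mean_sum_sq_abs:
  "(\<integral>x. (mean_sum N k g x)\<^sup>2 \<partial>M) \<le> (\<integral>x. (mean_sum N k (\<lambda>n. \<bar>g n\<bar>) x)\<^sup>2 \<partial>M)"
  unfolding integral_mean_sum_sq
  by (intro sum_mono mult_right_mono integral_mean_mean_nonneg) (simp flip: abs_mult)

text \<open>Expanding the square leads to integrals of products of two means, and \<open>integral_mean_mean_le\<close>
  replaces each by two single means of length \<open>2 k + 1\<close>. The result is four times the inner
  product of the function that belongs to \<open>2 k + 1\<close> with \<open>\<Sum>\<^sub>n g\<^sub>n p\<^sub>n\<close>.\<close>

lemma integral_mean_sum_sq_step: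
  assumes g: "\<And>n. g n \<ge> 0"
  shows "(\<integral>x. (mean_sum N k g x)\<^sup>2 \<partial>M)
    \<le> 4 * sqrt (\<integral>x. (mean_sum N (\<lambda>n. 2 * k n + 1) g x)\<^sup>2 \<partial>M) * sqrt (\<Sum>n<N. (g n)\<^sup>2)"
proof -
  let ?k' = "\<lambda>n. 2 * k n + 1"
  let ?S = "\<lambda>x. \<Sum>n<N. g n * p n x"
  let ?I = "\<integral>x. mean_sum N ?k' g x * ?S x \<partial>M"
  have I: "?I = (\<Sum>n<N. \<Sum>m<N. g n * g m * (\<integral>x. (power_mean (2 * k n + 1) (y x) * p n x) * p m x \<partial>M))"
  proof -
    have "(\<integral>x. (power_mean l (y x) * p n x) * ?S x \<partial>M)
        = (\<Sum>m<N. g m * (\<integral>x. (power_mean l (y x) * p n x) * p m x \<partial>M))" for n l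
      using integral_sum_p_mult[of "\<lambda>x. power_mean l (y x) * p n x" g "{..<N}"]
      by (simp add: continuous_intros mult.commute)
    then show ?thesis
      by (subst integral_mean_sum_mult) (auto intro!: continuous_intros simp: sum_distrib_left mult.assoc)
  qed
  have I': "?I = (\<Sum>n<N. \<Sum>m<N. g n * g m * (\<integral>x. p n x * (power_mean (2 * k m + 1) (y x) * p m x) \<partial>M))"
    unfolding I by (subst sum.swap) (simp add: mult_ac)
  have "(\<integral>x. (mean_sum N k g x)\<^sup>2 \<partial>M) \<le> (\<Sum>n<N. \<Sum>m<N. g n * g m *
      (2 * (\<integral>x. (power_mean (2 * k n + 1) (y x) * p n x) * p m x \<partial>M)
        + 2 * (\<integral>x. p n x * (power_mean (2 * k m + 1) (y x) * p m x) \<partial>M)))"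
    unfolding integral_mean_sum_sq
    by (intro sum_mono mult_left_mono integral_mean_mean_le mult_nonneg_nonneg g)
  also have "\<dots> = 2 * ?I + 2 * ?I"
    unfolding I I' [folded I]
    by (subst (2) I'[unfolded I]) (simp add: distrib_left sum.distrib sum_distrib_left mult_ac)
  finally have 1: "(\<integral>x. (mean_sum N k g x)\<^sup>2 \<partial>M) \<le> 4 * ?I" by simp
  have "?I\<^sup>2 \<le> (\<integral>x. (mean_sum N ?k' g x)\<^sup>2 \<partial>M) * (\<integral>x. (?S x)\<^sup>2 \<partial>M)"
    by (intro Cauchy_Schwarz_integral continuous_intros)
  also have "(\<integral>x. (?S x)\<^sup>2 \<partial>M) = (\<Sum>n<N. (g n)\<^sup>2)"
    by (rule integral_sum_p_sq) simp
  finally have "?I \<le> sqrt ((\<integral>x. (mean_sum N ?k' g x)\<^sup>2 \<partial>M) * (\<Sum>n<N. (g n)\<^sup>2))"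
    by (rule real_le_rsqrt)
  with 1 show ?thesis by (simp add: real_sqrt_mult mult.assoc)
qed

text \<open>The step above bounds the integral for \<open>k\<close> by the square root of the integral for \<open>2 k + 1\<close>, so
  it improves the supremum over all choices of \<open>k\<close> once that is known to be finite. Finiteness
  with a bound that depends on \<open>g\<close> is trivial, as the means take values in \<open>[0, 1]\<close>.\<close>

lemma integral_mean_sum_sq_le: "(\<integral>x. (mean_sum N k g x)\<^sup>2 \<partial>M) \<le> 16 * (\<Sum>n<N. (g n)\<^sup>2)"
proof -
  define Q where "Q k = (\<integral>x. (mean_sum N k (\<lambda>n. \<bar>g n\<bar>) x)\<^sup>2 \<partial>M)" for k
  define \<Gamma> where "\<Gamma> = (\<Sum>n<N. (g n)\<^sup>2)"
  have \<Gamma>: "\<Gamma> \<ge> 0" by (simp add: \<Gamma>_def sum_nonneg)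
  have Q_nonneg: "Q k \<ge> 0" for k by (simp add: Q_def)
  have "Q k \<le> (\<integral>x. (\<Sum>n<N. \<bar>g n\<bar> * \<bar>p n x\<bar>)\<^sup>2 \<partial>M)" for k
    unfolding Q_def
  proof (rule integral_mono_cont)
    fix x :: real assume x: "x \<in> {-1..1}"
    have "\<bar>mean_sum N k (\<lambda>n. \<bar>g n\<bar>) x\<bar> \<le> (\<Sum>n<N. \<bar>\<bar>g n\<bar> * (power_mean (k n) (y x) * p n x)\<bar>)"
      unfolding mean_sum_def by (rule sum_abs)
    also have "\<dots> \<le> (\<Sum>n<N. \<bar>g n\<bar> * \<bar>p n x\<bar>)"
      using power_mean_bounds[OF y_bounds[OF x]]
      by (intro sum_mono) (auto simp: abs_mult intro!: mult_left_mono mult_left_le_one_le)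
    finally have "\<bar>mean_sum N k (\<lambda>n. \<bar>g n\<bar>) x\<bar>\<^sup>2 \<le> (\<Sum>n<N. \<bar>g n\<bar> * \<bar>p n x\<bar>)\<^sup>2"
      by (intro power_mono) auto
    then show "(mean_sum N k (\<lambda>n. \<bar>g n\<bar>) x)\<^sup>2 \<le> (\<Sum>n<N. \<bar>g n\<bar> * \<bar>p n x\<bar>)\<^sup>2" by simp
  qed (intro continuous_intros)+
  then have bdd: "bdd_above (range Q)" by (intro bdd_aboveI2)
  define S where "S = (SUP k. Q k)"
  have Q_le_S: "Q k \<le> S" for k unfolding S_def by (intro cSUP_upper bdd) simp
  have S: "S \<ge> 0" using Q_nonneg Q_le_S order_trans by blast
  have "S \<le> 4 * sqrt S * sqrt \<Gamma>"
    unfolding S_def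
  proof (rule cSUP_least)
    fix k
    have "Q k \<le> 4 * sqrt (Q (\<lambda>n. 2 * k n + 1)) * sqrt \<Gamma>"
      using integral_mean_sum_sq_step[of "\<lambda>n. \<bar>g n\<bar>" N k] by (simp add: Q_def \<Gamma>_def)
    also have "\<dots> \<le> 4 * sqrt S * sqrt \<Gamma>"
      using Q_le_S \<Gamma> by (intro mult_right_mono mult_left_mono) auto
    finally show "Q k \<le> 4 * sqrt (SUP k. Q k) * sqrt \<Gamma>" by (simp add: S_def)
  qed simp
  then have "sqrt S * sqrt S \<le> sqrt S * (4 * sqrt \<Gamma>)" using S by (simp add: mult_ac)
  then have "sqrt S \<le> 4 * sqrt \<Gamma>"
  proof (cases "S = 0")
    case False
    then have "sqrt S > 0" using S by simp
    then show ?thesis using \<open>sqrt S * sqrt S \<le> _\<close> by (rule mult_left_le_imp_le[rotated])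
  qed (use \<Gamma> in auto)
  then have "(sqrt S)\<^sup>2 \<le> (4 * sqrt \<Gamma>)\<^sup>2" using S by (intro power_mono) auto
  then have "S \<le> 16 * \<Gamma>" using S \<Gamma> by (simp add: power_mult_distrib)
  then show ?thesis
    using integral_mean_sum_sq_abs[of N k g] Q_le_S[of k] by (simp add: Q_def \<Gamma>_def)
qed

text \<open>Duality: the left-hand side is the integral of \<open>F\<close> against the \<open>mean_sum\<close> whose coefficients are
  the integrals themselves.\<close>

lemma maximal_power_mean:
  assumes F: "continuous_on UNIV F"
  shows "(\<Sum>n<N. (\<integral>x. power_mean (k n) (y x) * p n x * F x \<partial>M)\<^sup>2) \<le> 16 * (\<integral>x. (F x)\<^sup>2 \<partial>M)"
proof -
  define g where "g n = (\<integral>x. power_mean (k n) (y x) * p n x * F x \<partial>M)" for n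
  define \<Gamma> where "\<Gamma> = (\<Sum>n<N. (g n)\<^sup>2)"
  have "(\<integral>x. mean_sum N k g x * F x \<partial>M) = \<Gamma>"
    unfolding integral_mean_sum_mult[OF F] by (simp add: g_def \<Gamma>_def power2_eq_square)
  then have "\<Gamma>\<^sup>2 \<le> (\<integral>x. (mean_sum N k g x)\<^sup>2 \<partial>M) * (\<integral>x. (F x)\<^sup>2 \<partial>M)"
    using Cauchy_Schwarz_integral[OF continuous_mean_sum F] by metis
  also have "\<dots> \<le> 16 * \<Gamma> * (\<integral>x. (F x)\<^sup>2 \<partial>M)"
    unfolding \<Gamma>_def by (intro mult_right_mono integral_mean_sum_sq_le) simp
  finally have "\<Gamma> * \<Gamma> \<le> \<Gamma> * (16 * (\<integral>x. (F x)\<^sup>2 \<partial>M))"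
    by (simp add: power2_eq_square mult_ac)
  moreover have "\<Gamma> \<ge> 0" by (simp add: \<Gamma>_def sum_nonneg)
  ultimately have "\<Gamma> \<le> 16 * (\<integral>x. (F x)\<^sup>2 \<partial>M)"
    by (cases "\<Gamma> = 0") auto
  then show ?thesis by (simp add: \<Gamma>_def g_def)
qed

text \<open>By \<open>power_minus_power_mean\<close> and the Cauchy-Schwarz inequality the \<open>n\<close>-th summand is at most
  \<open>\<Sum>\<^sub>j j e(n,j)\<^sup>2\<close>, where \<open>e(n,j)\<close> is the coefficient of \<open>(y\<^sup>j - y\<^bsup>j-1\<^esup>) F\<close> with respect to \<open>p n\<close>.
  This bound is independent of \<open>k n\<close>, and it is summed over \<open>n\<close> by Bessel's inequality.\<close>

lemma square_function_power:
  assumes F: "continuous_on UNIV F"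
  shows "(\<Sum>n<N. (\<integral>x. (y x ^ k n - power_mean (k n) (y x)) * p n x * F x \<partial>M)\<^sup>2) \<le> (\<integral>x. (F x)\<^sup>2 \<partial>M)"
proof -
  define D where "D j x = y x ^ j - y x ^ (j - 1)" for j x
  have D [continuous_intros]: "continuous_on S (D j)" for S j
    unfolding D_def[abs_def] by (intro continuous_intros)
  define e where "e n j = (\<integral>x. p n x * (D j x * F x) \<partial>M)" for n j
  define K where "K = Max (insert 0 (k ` {..<N}))"
  have "(\<integral>x. (y x ^ k n - power_mean (k n) (y x)) * p n x * F x \<partial>M)\<^sup>2 \<le> (\<Sum>j\<in>{1..K}. real j * (e n j)\<^sup>2)"
    if "n < N" for n
  proof -
    let ?k = "k n"
    have "?k \<le> K" using that unfolding K_def by (intro Max_ge) auto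
    have "(\<integral>x. (y x ^ ?k - power_mean ?k (y x)) * p n x * F x \<partial>M)
        = (\<integral>x. (\<Sum>j\<in>{1..?k}. real j * (p n x * (D j x * F x))) / (real ?k + 1) \<partial>M)"
      unfolding power_minus_power_mean by (simp add: D_def sum_distrib_left sum_distrib_right mult_ac)
    also have "\<dots> = (\<Sum>j\<in>{1..?k}. real j * e n j) / (real ?k + 1)"
      using F by (simp add: e_def integral_sum_cont continuous_on_mult continuous_p D)
    finally have "(\<integral>x. (y x ^ ?k - power_mean ?k (y x)) * p n x * F x \<partial>M)\<^sup>2
        = (\<Sum>j\<in>{1..?k}. sqrt (real j) * (sqrt (real j) * e n j))\<^sup>2 / (real ?k + 1)\<^sup>2"
      by (simp add: power_divide flip: mult.assoc)
    also have "\<dots> \<le> ((\<Sum>j\<in>{1..?k}. (sqrt (real j))\<^sup>2) * (\<Sum>j\<in>{1..?k}. (sqrt (real j) * e n j)\<^sup>2)) / (real ?k + 1)\<^sup>2"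
      by (intro divide_right_mono Cauchy_Schwarz_ineq_sum) simp
    also have "\<dots> = (\<Sum>j\<in>{1..?k}. real j) / (real ?k + 1)\<^sup>2 * (\<Sum>j\<in>{1..?k}. real j * (e n j)\<^sup>2)"
      by (simp add: power_mult_distrib)
    also have "\<dots> \<le> 1 * (\<Sum>j\<in>{1..?k}. real j * (e n j)\<^sup>2)"
    proof (rule mult_right_mono)
      have "(\<Sum>j\<in>{1..?k}. real j) \<le> (\<Sum>j\<in>{1..?k}. real ?k + 1)" by (intro sum_mono) auto
      also have "\<dots> \<le> (real ?k + 1)\<^sup>2" by (simp add: power2_eq_square algebra_simps)
      finally show "(\<Sum>j\<in>{1..?k}. real j) / (real ?k + 1)\<^sup>2 \<le> 1" by (simp add: divide_le_eq_1)
    qed (auto intro: sum_nonneg)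
    also have "1 * (\<Sum>j\<in>{1..?k}. real j * (e n j)\<^sup>2) \<le> (\<Sum>j\<in>{1..K}. real j * (e n j)\<^sup>2)"
      using \<open>?k \<le> K\<close> by (simp, intro sum_mono2) auto
    finally show ?thesis .
  qed
  then have "(\<Sum>n<N. (\<integral>x. (y x ^ k n - power_mean (k n) (y x)) * p n x * F x \<partial>M)\<^sup>2)
      \<le> (\<Sum>n<N. \<Sum>j\<in>{1..K}. real j * (e n j)\<^sup>2)"
    by (intro sum_mono) auto
  also have "\<dots> = (\<Sum>j\<in>{1..K}. real j * (\<Sum>n<N. (e n j)\<^sup>2))"
    by (subst sum.swap) (simp add: sum_distrib_left)
  also have "\<dots> \<le> (\<Sum>j\<in>{1..K}. real j * (\<integral>x. (D j x * F x)\<^sup>2 \<partial>M))"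
    unfolding e_def using F by (intro sum_mono mult_left_mono Bessel_inequality continuous_intros) auto
  also have "\<dots> = (\<integral>x. (\<Sum>j\<in>{1..K}. real j * (D j x * F x)\<^sup>2) \<partial>M)"
    using F by (simp add: integral_sum_cont continuous_on_mult continuous_on_power D)
  also have "\<dots> \<le> (\<integral>x. (F x)\<^sup>2 \<partial>M)"
  proof (rule integral_mono_cont)
    fix x :: real assume x: "x \<in> {-1..1}"
    have "(\<Sum>j\<in>{1..K}. real j * (D j x * F x)\<^sup>2) = (\<Sum>j\<in>{1..K}. real j * (D j x)\<^sup>2) * (F x)\<^sup>2"
      by (simp add: sum_distrib_left sum_distrib_right power_mult_distrib mult_ac)
    also have "\<dots> \<le> 1 * (F x)\<^sup>2"
      unfolding D_def by (intro mult_right_mono square_function_sum_le y_bounds x) auto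
    finally show "(\<Sum>j\<in>{1..K}. real j * (D j x * F x)\<^sup>2) \<le> (F x)\<^sup>2" by simp
  qed (use F in \<open>auto intro!: continuous_intros D\<close>)
  finally show ?thesis .
qed

lemma maximal_power:
  assumes F: "continuous_on UNIV F"
  shows "(\<Sum>n<N. (\<integral>x. y x ^ k n * p n x * F x \<partial>M)\<^sup>2) \<le> 34 * (\<integral>x. (F x)\<^sup>2 \<partial>M)"
proof -
  let ?A = "\<lambda>n. \<integral>x. power_mean (k n) (y x) * p n x * F x \<partial>M"
  let ?D = "\<lambda>n. \<integral>x. (y x ^ k n - power_mean (k n) (y x)) * p n x * F x \<partial>M"
  have "(\<integral>x. y x ^ k n * p n x * F x \<partial>M) = ?A n + ?D n" for n
  proof -
    have "(\<integral>x. y x ^ k n * p n x * F x \<partial>M)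
        = (\<integral>x. power_mean (k n) (y x) * p n x * F x + (y x ^ k n - power_mean (k n) (y x)) * p n x * F x \<partial>M)"
      by (simp add: algebra_simps)
    also have "\<dots> = ?A n + ?D n"
      using F by (intro Bochner_Integration.integral_add integrable_cont continuous_intros)
    finally show ?thesis .
  qed
  moreover have "(u + v)\<^sup>2 \<le> 2 * u\<^sup>2 + 2 * v\<^sup>2" for u v :: real
    using sum_squares_bound[of u v] by (simp add: power2_sum)
  ultimately have "(\<Sum>n<N. (\<integral>x. y x ^ k n * p n x * F x \<partial>M)\<^sup>2) \<le> (\<Sum>n<N. 2 * (?A n)\<^sup>2 + 2 * (?D n)\<^sup>2)"
    by (simp only:) (intro sum_mono)
  also have "\<dots> \<le> 34 * (\<integral>x. (F x)\<^sup>2 \<partial>M)"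
    using maximal_power_mean[OF F, of k N] square_function_power[OF F, of k N]
    by (simp add: sum.distrib flip: sum_distrib_left)
  finally show ?thesis .
qed

section \<open>The semigroup of multiplications by exponentials\<close>

lemma exp_moment_sums:
  assumes P: "continuous_on UNIV P"
  shows "(\<lambda>k. (\<integral>x. y x ^ k * P x \<partial>M) / fact k * s ^ k) sums (\<integral>x. exp (s * y x) * P x \<partial>M)"
proof -
  let ?f = "\<lambda>k x. (s * y x) ^ k /\<^sub>R fact k * P x"
  have f: "continuous_on UNIV (?f k)" for k using P by (intro continuous_intros)
  have ex: "(\<lambda>k. ?f k x) sums (exp (s * y x) * P x)" for x
    by (intro sums_mult2 exp_converges)
  have "(\<lambda>k. integral\<^sup>L M (?f k)) sums (\<integral>x. (\<Sum>k. ?f k x) \<partial>M)"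
  proof (rule sums_integral)
    show "integrable M (?f k)" for k by (rule integrable_cont[OF f])
    show "AE x in M. summable (\<lambda>k. norm (?f k x))"
      using summable_norm_exp[of "s * y x" for x]
      by (intro AE_I2) (simp only: norm_mult, rule summable_mult2, simp)
    show "summable (\<lambda>k. \<integral>x. norm (?f k x) \<partial>M)"
    proof (rule summable_comparison_test')
      show "summable (\<lambda>k. norm (\<bar>s\<bar> ^ k /\<^sub>R fact k) * (\<integral>x. \<bar>P x\<bar> \<partial>M))"
        by (intro summable_mult2 summable_norm_exp)
      fix k
      have "(\<integral>x. norm (?f k x) \<partial>M) \<le> (\<integral>x. norm (\<bar>s\<bar> ^ k /\<^sub>R fact k) * \<bar>P x\<bar> \<partial>M)"
      proof (rule integral_mono_cont)
        fix x :: real assume x: "x \<in> {-1..1}"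
        have "\<bar>s * y x\<bar> ^ k \<le> \<bar>s\<bar> ^ k"
          using y_bounds[OF x] by (intro power_mono) (auto simp: abs_mult mult_left_le)
        then show "norm (?f k x) \<le> norm (\<bar>s\<bar> ^ k /\<^sub>R fact k) * \<bar>P x\<bar>"
          by (simp add: abs_mult power_abs mult_right_mono)
      qed (use P in \<open>auto intro!: continuous_intros\<close>)
      then show "norm (\<integral>x. norm (?f k x) \<partial>M) \<le> norm (\<bar>s\<bar> ^ k /\<^sub>R fact k) * (\<integral>x. \<bar>P x\<bar> \<partial>M)"
        by simp
    qed
  qed
  also have "(\<lambda>x. \<Sum>k. ?f k x) = (\<lambda>x. exp (s * y x) * P x)"
    using ex by (auto simp: sums_iff)
  also have "(\<lambda>k. integral\<^sup>L M (?f k)) = (\<lambda>k. (\<integral>x. y x ^ k * P x \<partial>M) / fact k * s ^ k)"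
  proof
    fix k
    have "integral\<^sup>L M (?f k) = (\<integral>x. (s ^ k / fact k) * (y x ^ k * P x) \<partial>M)"
      by (rule Bochner_Integration.integral_cong) (simp_all add: power_mult_distrib field_simps)
    then show "integral\<^sup>L M (?f k) = (\<integral>x. y x ^ k * P x \<partial>M) / fact k * s ^ k" by simp
  qed
  finally show ?thesis .
qed

lemma exp_semigroup_eq: "exp (- (1 - x) * t) = exp (- 2 * t) * exp (2 * t * y x)"
  by (simp add: y_def algebra_simps flip: exp_add)

lemma semigroup_integral_eq:
  "(\<integral>x. exp (- (1 - x) * t) * P x \<partial>M) = exp (- 2 * t) * (\<integral>x. exp (2 * t * y x) * P x \<partial>M)"
  unfolding exp_semigroup_eq mult.assoc by simp

text \<open>The power series in \<open>exp_moment_sums\<close> may be differentiated termwise, and this shifts the moments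
  by one, i.e. multiplies \<open>P\<close> by \<open>y\<close>. The factor \<open>x - 1\<close> appears as \<open>2 (y - 1)\<close>.\<close>

lemma has_derivative_semigroup_integral:
  assumes P: "continuous_on UNIV P"
  shows "((\<lambda>t. \<integral>x. exp (- (1 - x) * t) * P x \<partial>M) has_real_derivative
           (\<integral>x. (x - 1) * (exp (- (1 - x) * t) * P x) \<partial>M)) (at t)"
proof -
  define c where "c k = (\<integral>x. y x ^ k * P x \<partial>M) / fact k" for k
  define \<Phi> where "\<Phi> s = (\<integral>x. exp (s * y x) * P x \<partial>M)" for s
  have \<Phi>: "(\<lambda>k. c k * s ^ k) sums \<Phi> s" for s
    using exp_moment_sums[OF P] by (simp add: c_def \<Phi>_def)
  have "diffs c k * s ^ k = (\<integral>x. y x ^ k * (y x * P x) \<partial>M) / fact k * s ^ k" for k s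
    by (simp add: diffs_def c_def mult_ac)
  then have \<Phi>': "(\<lambda>k. diffs c k * s ^ k) sums (\<integral>x. exp (s * y x) * (y x * P x) \<partial>M)" for s
    using exp_moment_sums[of "\<lambda>x. y x * P x" s] P by (simp add: continuous_on_mult continuous_y)
  have "((\<lambda>s. \<Sum>k. c k * s ^ k) has_real_derivative (\<Sum>k. diffs c k * s ^ k)) (at s)" for s
    using \<Phi> by (intro termdiffs_strong_converges_everywhere) (auto simp: sums_iff)
  then have \<Phi>_deriv: "(\<Phi> has_real_derivative (\<integral>x. exp (s * y x) * (y x * P x) \<partial>M)) (at s)" for s
    using \<Phi> \<Phi>' by (simp add: sums_iff)
  have "((\<lambda>t. exp (- 2 * t) * \<Phi> (2 * t)) has_real_derivative
      exp (- 2 * t) * ((\<integral>x. exp (2 * t * y x) * (y x * P x) \<partial>M) * 2) + (exp (- 2 * t) * - 2) * \<Phi> (2 * t)) (at t)"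
    by (auto intro!: derivative_eq_intros DERIV_chain2[OF \<Phi>_deriv])
  moreover have "exp (- 2 * t) * ((\<integral>x. exp (2 * t * y x) * (y x * P x) \<partial>M) * 2) + (exp (- 2 * t) * - 2) * \<Phi> (2 * t)
      = (\<integral>x. (x - 1) * (exp (- (1 - x) * t) * P x) \<partial>M)"
  proof -
    have int: "integrable M (\<lambda>x. exp (2 * t * y x) * (y x * P x))" "integrable M (\<lambda>x. exp (2 * t * y x) * P x)"
      using P by (auto intro!: integrable_cont continuous_intros)
    have "(\<lambda>x. (x - 1) * (exp (- (1 - x) * t) * P x))
        = (\<lambda>x. (2 * exp (- 2 * t)) * (exp (2 * t * y x) * (y x * P x)) - (2 * exp (- 2 * t)) * (exp (2 * t * y x) * P x))"
      unfolding exp_semigroup_eq by (rule ext) (simp add: y_def field_simps)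
    then have "(\<integral>x. (x - 1) * (exp (- (1 - x) * t) * P x) \<partial>M)
        = (2 * exp (- 2 * t)) * (\<integral>x. exp (2 * t * y x) * (y x * P x) \<partial>M) - (2 * exp (- 2 * t)) * (\<integral>x. exp (2 * t * y x) * P x \<partial>M)"
      using int by simp
    then show ?thesis by (simp add: \<Phi>_def)
  qed
  moreover have "(\<lambda>t. exp (- 2 * t) * \<Phi> (2 * t)) = (\<lambda>t. \<integral>x. exp (- (1 - x) * t) * P x \<partial>M)"
    by (simp only: semigroup_integral_eq \<Phi>_def)
  ultimately show ?thesis by simp
qed

text \<open>The left-hand side is the absolute value of an average of the moments, with the weights
  \<open>exp (- 2 * t) * (2 * t) ^ k / fact k\<close> of a Poisson distribution.\<close>

lemma semigroup_integral_le_SUP: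
  assumes P: "continuous_on UNIV P" and t: "t \<ge> 0"
    and bdd: "bdd_above (range (\<lambda>k. \<bar>\<integral>x. y x ^ k * P x \<partial>M\<bar>))"
  shows "\<bar>\<integral>x. exp (- (1 - x) * t) * P x \<partial>M\<bar> \<le> (SUP k. \<bar>\<integral>x. y x ^ k * P x \<partial>M\<bar>)"
proof -
  define S where "S = (SUP k. \<bar>\<integral>x. y x ^ k * P x \<partial>M\<bar>)"
  let ?c = "\<lambda>k. (\<integral>x. y x ^ k * P x \<partial>M) / fact k * (2 * t) ^ k"
  have sums: "?c sums (\<integral>x. exp (2 * t * y x) * P x \<partial>M)" by (rule exp_moment_sums[OF P])
  have exp: "(\<lambda>k. S * ((2 * t) ^ k /\<^sub>R fact k)) sums (S * exp (2 * t))"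
    by (intro sums_mult exp_converges)
  have le: "\<bar>?c k\<bar> \<le> S * ((2 * t) ^ k /\<^sub>R fact k)" for k
  proof -
    have "\<bar>\<integral>x. y x ^ k * P x \<partial>M\<bar> \<le> S" unfolding S_def by (intro cSUP_upper bdd) simp
    then have "\<bar>\<integral>x. y x ^ k * P x \<partial>M\<bar> * ((2 * t) ^ k / fact k) \<le> S * ((2 * t) ^ k / fact k)"
      using t by (intro mult_right_mono) auto
    then show ?thesis using t by (simp add: abs_mult field_simps)
  qed
  have "\<bar>\<Sum>k. ?c k\<bar> \<le> (\<Sum>k. S * ((2 * t) ^ k /\<^sub>R fact k))"
    using norm_suminf_le[of ?c "\<lambda>k. S * ((2 * t) ^ k /\<^sub>R fact k)"] le exp by (simp add: sums_iff)
  then have "\<bar>\<integral>x. exp (2 * t * y x) * P x \<partial>M\<bar> \<le> S * exp (2 * t)"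
    using sums exp by (simp add: sums_iff)
  then have "exp (- 2 * t) * \<bar>\<integral>x. exp (2 * t * y x) * P x \<partial>M\<bar> \<le> exp (- 2 * t) * (S * exp (2 * t))"
    by (intro mult_left_mono) auto
  then show ?thesis
    unfolding semigroup_integral_eq by (simp add: S_def abs_mult exp_minus field_simps)
qed

lemma maximal_semigroup:
  assumes F: "continuous_on UNIV F" and \<tau>: "\<And>n. \<tau> n \<ge> 0"
  shows "(\<Sum>n<N. (\<integral>x. exp (- (1 - x) * \<tau> n) * (p n x * F x) \<partial>M)\<^sup>2) \<le> 34 * (\<integral>x. (F x)\<^sup>2 \<partial>M)"
proof -
  let ?h = "\<lambda>n k. \<integral>x. y x ^ k * (p n x * F x) \<partial>M"
  have choice: "(\<Sum>n\<in>{..<N}. (?h n (\<kappa> n))\<^sup>2) \<le> 34 * (\<integral>x. (F x)\<^sup>2 \<partial>M)" for \<kappa> :: "nat \<Rightarrow> nat"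
    using maximal_power[OF F, of \<kappa> N] by (simp only: mult.assoc)
  have bdd: "bdd_above (range (\<lambda>k. \<bar>?h n k\<bar>))" if "n < N" for n
    using sum_SUP_le_of_choice(1)[of "{..<N}" UNIV ?h, OF _ _ choice] that by auto
  have "(\<Sum>n<N. (\<integral>x. exp (- (1 - x) * \<tau> n) * (p n x * F x) \<partial>M)\<^sup>2) \<le> (\<Sum>n<N. (SUP k. \<bar>?h n k\<bar>)\<^sup>2)"
  proof (rule sum_mono)
    fix n assume "n \<in> {..<N}"
    then have "\<bar>\<integral>x. exp (- (1 - x) * \<tau> n) * (p n x * F x) \<partial>M\<bar> \<le> (SUP k. \<bar>?h n k\<bar>)"
      using F \<tau> bdd by (intro semigroup_integral_le_SUP) (auto intro!: continuous_intros)
    then have "\<bar>\<integral>x. exp (- (1 - x) * \<tau> n) * (p n x * F x) \<partial>M\<bar>\<^sup>2 \<le> (SUP k. \<bar>?h n k\<bar>)\<^sup>2"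
      by (intro power_mono) auto
    then show "(\<integral>x. exp (- (1 - x) * \<tau> n) * (p n x * F x) \<partial>M)\<^sup>2 \<le> (SUP k. \<bar>?h n k\<bar>)\<^sup>2" by simp
  qed
  also have "\<dots> \<le> 34 * (\<integral>x. (F x)\<^sup>2 \<partial>M)"
    using sum_SUP_le_of_choice(2)[of "{..<N}" UNIV ?h, OF _ _ choice] by simp
  finally show ?thesis .
qed

section \<open>The evolution equation\<close>

definition kernel :: "real \<Rightarrow> nat \<Rightarrow> nat \<Rightarrow> real" where
  "kernel t m n = (\<integral>x. exp (- (1 - x) * t) * (p m x * p n x) \<partial>M)"

definition generator :: "(nat \<Rightarrow> real) \<Rightarrow> nat \<Rightarrow> real" where
  "generator c n = (if n = 0 then 0 else a (n - 1) * c (n - 1)) + (b n - 1) * c n + a n * c (Suc n)"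

lemma has_derivative_kernel:
  "((\<lambda>t. kernel t m n) has_real_derivative generator (kernel t m) n) (at t)"
proof -
  let ?F = "\<lambda>x. exp (- (1 - x) * t) * p m x"
  have F: "continuous_on UNIV ?F" by (intro continuous_intros)
  have int: "integrable M (\<lambda>x. x * p n x * ?F x)" "integrable M (\<lambda>x. p n x * ?F x)"
    by (intro integrable_cont continuous_intros)+
  have eq: "(\<integral>x. p k x * ?F x \<partial>M) = kernel t m k" for k
    by (simp add: kernel_def mult_ac)
  have "(\<integral>x. (x - 1) * (exp (- (1 - x) * t) * (p m x * p n x)) \<partial>M)
      = (\<integral>x. x * p n x * ?F x - p n x * ?F x \<partial>M)"
    by (rule Bochner_Integration.integral_cong) (simp_all add: algebra_simps)
  also have "\<dots> = (\<integral>x. x * p n x * ?F x \<partial>M) - (\<integral>x. p n x * ?F x \<partial>M)"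
    using int by (rule Bochner_Integration.integral_diff)
  also have "\<dots> = generator (kernel t m) n"
    unfolding integral_x_p_mult[OF F] eq generator_def by (simp add: algebra_simps)
  finally show ?thesis
    using has_derivative_semigroup_integral[of "\<lambda>x. p m x * p n x" t]
    by (simp add: kernel_def continuous_on_mult continuous_p)
qed

lemma kernel_0: "kernel 0 m n = (if m = n then 1 else 0)"
  by (simp add: kernel_def ortho)

lemma kernel_sum_sq_le_1:
  assumes t: "t \<ge> 0"
  shows "(\<Sum>m<N. (kernel t m n)\<^sup>2) \<le> 1"
proof -
  let ?F = "\<lambda>x. exp (- (1 - x) * t) * p n x"
  have "(\<Sum>m<N. (kernel t m n)\<^sup>2) = (\<Sum>m<N. (\<integral>x. p m x * ?F x \<partial>M)\<^sup>2)"
    by (simp add: kernel_def mult_ac)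
  also have "\<dots> \<le> (\<integral>x. (?F x)\<^sup>2 \<partial>M)"
    by (intro Bessel_inequality continuous_intros)
  also have "\<dots> \<le> (\<integral>x. (p n x)\<^sup>2 \<partial>M)"
  proof (rule integral_mono_cont)
    fix x :: real assume "x \<in> {-1..1}"
    then have "exp (- (1 - x) * t) \<le> 1" using t by (simp add: mult_nonpos_nonneg)
    then have "\<bar>?F x\<bar> \<le> \<bar>p n x\<bar>" by (simp add: abs_mult mult_left_le_one_le)
    then show "(?F x)\<^sup>2 \<le> (p n x)\<^sup>2" by (simp only: abs_le_square_iff)
  qed (intro continuous_intros)+
  finally show ?thesis by (simp add: sqnorm_p)
qed

lemma kernel_sum_abs_le:
  assumes t: "t \<ge> 0" and A: "A \<subseteq> {..<N}"
  shows "\<bar>\<Sum>m\<in>A. f m * kernel t m n\<bar> \<le> sqrt (\<Sum>m\<in>A. (f m)\<^sup>2)"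
proof -
  have "(\<Sum>m\<in>A. f m * kernel t m n)\<^sup>2 \<le> (\<Sum>m\<in>A. (f m)\<^sup>2) * (\<Sum>m\<in>A. (kernel t m n)\<^sup>2)"
    by (rule Cauchy_Schwarz_ineq_sum)
  also have "(\<Sum>m\<in>A. (kernel t m n)\<^sup>2) \<le> (\<Sum>m<N. (kernel t m n)\<^sup>2)"
    using A by (intro sum_mono2) auto
  also have "\<dots> \<le> 1" by (rule kernel_sum_sq_le_1[OF t])
  finally have "\<bar>\<Sum>m\<in>A. f m * kernel t m n\<bar>\<^sup>2 \<le> (\<Sum>m\<in>A. (f m)\<^sup>2)"
    by (simp add: mult_left_mono sum_nonneg)
  then show ?thesis by (rule real_le_rsqrt)
qed

definition evolution :: "(nat \<Rightarrow> real) \<Rightarrow> nat \<Rightarrow> real \<Rightarrow> real" where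
  "evolution f n t = (\<Sum>m. f m * kernel t m n)"

lemma summable_kernel:
  assumes f: "summable (\<lambda>n. (f n)\<^sup>2)" and t: "t \<ge> 0"
  shows "summable (\<lambda>m. f m * kernel t m n)"
proof (rule summable_comparison_test')
  have "summable (\<lambda>m. (kernel t m n)\<^sup>2)"
    by (rule summableI_nonneg_bounded[OF _ kernel_sum_sq_le_1[OF t]]) simp
  then show "summable (\<lambda>m. (f m)\<^sup>2 + (kernel t m n)\<^sup>2)" using f by (rule summable_add[rotated])
  show "norm (f m * kernel t m n) \<le> (f m)\<^sup>2 + (kernel t m n)\<^sup>2" for m
    using sum_squares_bound[of "\<bar>f m\<bar>" "\<bar>kernel t m n\<bar>"]
      mult_nonneg_nonneg[of "\<bar>f m\<bar>" "\<bar>kernel t m n\<bar>"]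
    by (simp add: abs_mult del: mult_nonneg_nonneg)
qed

text \<open>Cauchy-Schwarz and \<open>kernel_sum_sq_le_1\<close> give a bound for the tail of the series that does not
  depend on \<open>t\<close>.\<close>

lemma evolution_tail:
  assumes f: "summable (\<lambda>n. (f n)\<^sup>2)" and t: "t \<ge> 0"
  shows "\<bar>evolution f n t - (\<Sum>m<N. f m * kernel t m n)\<bar> \<le> sqrt ((\<Sum>m. (f m)\<^sup>2) - (\<Sum>m<N. (f m)\<^sup>2))"
proof (rule LIMSEQ_le_const2)
  show "(\<lambda>L. \<bar>(\<Sum>m<L. f m * kernel t m n) - (\<Sum>m<N. f m * kernel t m n)\<bar>)
      \<longlonglongrightarrow> \<bar>evolution f n t - (\<Sum>m<N. f m * kernel t m n)\<bar>"
    unfolding evolution_def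
    by (intro tendsto_rabs tendsto_diff tendsto_const summable_LIMSEQ summable_kernel f t)
  have "\<bar>(\<Sum>m<L. f m * kernel t m n) - (\<Sum>m<N. f m * kernel t m n)\<bar>
      \<le> sqrt ((\<Sum>m. (f m)\<^sup>2) - (\<Sum>m<N. (f m)\<^sup>2))" if "L \<ge> N" for L
  proof -
    have split: "(\<Sum>m<L. g m) - (\<Sum>m<N. g m) = (\<Sum>m\<in>{N..<L}. g m)" for g :: "nat \<Rightarrow> real"
      using sum_diff_nat_ivl[of 0 N L g] that by (simp add: atLeast0LessThan)
    have "\<bar>\<Sum>m\<in>{N..<L}. f m * kernel t m n\<bar> \<le> sqrt (\<Sum>m\<in>{N..<L}. (f m)\<^sup>2)"
      by (rule kernel_sum_abs_le[OF t, of _ L]) auto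
    also have "\<dots> \<le> sqrt ((\<Sum>m. (f m)\<^sup>2) - (\<Sum>m<N. (f m)\<^sup>2))"
      using sum_le_suminf[OF f, of "{..<L}"] unfolding split[symmetric] by simp
    finally show ?thesis unfolding split .
  qed
  then show "\<exists>K. \<forall>L\<ge>K. \<bar>(\<Sum>m<L. f m * kernel t m n) - (\<Sum>m<N. f m * kernel t m n)\<bar>
      \<le> sqrt ((\<Sum>m. (f m)\<^sup>2) - (\<Sum>m<N. (f m)\<^sup>2))" by blast
qed

lemma uniform_limit_evolution:
  assumes f: "summable (\<lambda>n. (f n)\<^sup>2)"
  shows "uniform_limit {0..} (\<lambda>N t. \<Sum>m<N. f m * kernel t m n) (evolution f n) sequentially"
proof (rule uniform_limitI)
  fix e :: real assume e: "e > 0"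
  have "(\<lambda>N. sqrt ((\<Sum>m. (f m)\<^sup>2) - (\<Sum>m<N. (f m)\<^sup>2))) \<longlonglongrightarrow> sqrt ((\<Sum>m. (f m)\<^sup>2) - (\<Sum>m. (f m)\<^sup>2))"
    by (intro tendsto_real_sqrt tendsto_diff tendsto_const summable_LIMSEQ f)
  then have "\<forall>\<^sub>F N in sequentially. sqrt ((\<Sum>m. (f m)\<^sup>2) - (\<Sum>m<N. (f m)\<^sup>2)) < e"
    using e by (intro order_tendstoD) auto
  then show "\<forall>\<^sub>F N in sequentially. \<forall>t\<in>{0..}. dist (\<Sum>m<N. f m * kernel t m n) (evolution f n t) < e"
  proof eventually_elim
    case (elim N)
    show ?case
    proof
      fix t :: real assume "t \<in> {0..}"
      then show "dist (\<Sum>m<N. f m * kernel t m n) (evolution f n t) < e"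
        using evolution_tail[OF f, of t n N] elim by (simp add: dist_real_def abs_minus_commute)
    qed
  qed
qed

lemma evolution_has_derivative:
  assumes f: "summable (\<lambda>n. (f n)\<^sup>2)" and t: "t \<ge> 0"
  shows "(evolution f n has_real_derivative generator (\<lambda>k. evolution f k t) n) (at t within {0..})"
proof -
  have partial: "(\<Sum>m<N. f m * generator (kernel t m) n) = generator (\<lambda>k. \<Sum>m<N. f m * kernel t m k) n" for N t
    by (induction N) (simp_all add: generator_def algebra_simps)
  have gen: "uniform_limit {0..} (\<lambda>N t. \<Sum>m<N. f m * generator (kernel t m) n)
      (\<lambda>t. generator (\<lambda>k. evolution f k t) n) sequentially"
    unfolding partial unfolding generator_def
    by (cases n) (auto intro!: uniform_limit_intros uniform_limit_evolution f
        bounded_linear.uniform_limit[OF bounded_linear_mult_right])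
  have "\<exists>g. \<forall>t\<in>{0..}. (\<lambda>m. f m * kernel t m n) sums g t \<and>
      (g has_real_derivative generator (\<lambda>k. evolution f k t) n) (at t within {0..})"
  proof (rule has_field_derivative_series)
    show "((\<lambda>t. f m * kernel t m n) has_real_derivative f m * generator (kernel t m) n) (at t within {0..})" for m t
      using DERIV_cmult[OF has_field_derivative_at_within[OF has_derivative_kernel]] .
    show "summable (\<lambda>m. f m * kernel 0 m n)" by (rule summable_kernel[OF f]) simp
  qed (use gen in auto)
  then obtain g where g: "\<And>t. t \<ge> 0 \<Longrightarrow> (\<lambda>m. f m * kernel t m n) sums g t"
      "\<And>t. t \<ge> 0 \<Longrightarrow> (g has_real_derivative generator (\<lambda>k. evolution f k t) n) (at t within {0..})"
    by auto
  show ?thesis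
    by (rule has_field_derivative_transform_within[OF g(2)[OF t] zero_less_one])
       (use t g(1) in \<open>auto simp: evolution_def sums_iff\<close>)
qed

lemma evolution_0: "evolution f n 0 = f n"
proof -
  have "(\<lambda>m. f m * kernel 0 m n) sums (\<Sum>m\<in>{n}. f m * kernel 0 m n)"
    by (rule sums_finite) (auto simp: kernel_0)
  then show ?thesis by (simp add: evolution_def kernel_0 sums_iff)
qed

text \<open>For finitely supported \<open>f\<close> this is \<open>maximal_semigroup\<close> with \<open>F = \<Sum>\<^sub>m f\<^sub>m p\<^sub>m\<close>; the constant does not
  depend on the support, so the bound survives the limit of the truncations of \<open>f\<close>.\<close>

lemma maximal_evolution:
  assumes f: "summable (\<lambda>n. (f n)\<^sup>2)" and \<tau>: "\<And>n. \<tau> n \<ge> 0"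
  shows "(\<Sum>n<N. (evolution f n (\<tau> n))\<^sup>2) \<le> 34 * (\<Sum>m. (f m)\<^sup>2)"
proof (rule LIMSEQ_le_const2)
  show "(\<lambda>L. \<Sum>n<N. (\<Sum>m<L. f m * kernel (\<tau> n) m n)\<^sup>2) \<longlonglongrightarrow> (\<Sum>n<N. (evolution f n (\<tau> n))\<^sup>2)"
    unfolding evolution_def
    by (intro tendsto_sum tendsto_power summable_LIMSEQ summable_kernel f \<tau>)
  have "(\<Sum>n<N. (\<Sum>m<L. f m * kernel (\<tau> n) m n)\<^sup>2) \<le> 34 * (\<Sum>m. (f m)\<^sup>2)" for L
  proof -
    let ?F = "\<lambda>x. \<Sum>m<L. f m * p m x"
    have "(\<Sum>m<L. f m * kernel t m n) = (\<integral>x. exp (- (1 - x) * t) * (p n x * ?F x) \<partial>M)" for t n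
    proof -
      have "(\<integral>x. ?F x * (exp (- (1 - x) * t) * p n x) \<partial>M) = (\<Sum>m<L. f m * kernel t m n)"
        by (subst integral_sum_p_mult) (auto intro!: continuous_intros simp: kernel_def mult_ac)
      then show ?thesis by (simp add: mult_ac)
    qed
    then have "(\<Sum>n<N. (\<Sum>m<L. f m * kernel (\<tau> n) m n)\<^sup>2)
        = (\<Sum>n<N. (\<integral>x. exp (- (1 - x) * \<tau> n) * (p n x * ?F x) \<partial>M)\<^sup>2)" by simp
    also have "\<dots> \<le> 34 * (\<integral>x. (?F x)\<^sup>2 \<partial>M)"
      by (intro maximal_semigroup \<tau> continuous_intros)
    also have "(\<integral>x. (?F x)\<^sup>2 \<partial>M) = (\<Sum>m<L. (f m)\<^sup>2)" by (simp add: integral_sum_p_sq)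
    also have "34 * \<dots> \<le> 34 * (\<Sum>m. (f m)\<^sup>2)"
      using sum_le_suminf[OF f, of "{..<L}"] by simp
    finally show ?thesis .
  qed
  then show "\<exists>K. \<forall>L\<ge>K. (\<Sum>n<N. (\<Sum>m<L. f m * kernel (\<tau> n) m n)\<^sup>2) \<le> 34 * (\<Sum>m. (f m)\<^sup>2)" by blast
qed

text \<open>The selection \<open>\<tau>\<close> in \<open>maximal_evolution\<close> is arbitrary, so the bound passes to the suprema.\<close>

lemma evolution_maximal_function:
  assumes f: "summable (\<lambda>n. (f n)\<^sup>2)"
  shows "bdd_above ((\<lambda>t. \<bar>evolution f n t\<bar>) ` {0<..})"
    and "summable (\<lambda>n. (SUP t\<in>{0<..}. \<bar>evolution f n t\<bar>)\<^sup>2)"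
proof -
  have choice: "(\<Sum>n\<in>{..<N}. (evolution f n (\<tau> n))\<^sup>2) \<le> 34 * (\<Sum>m. (f m)\<^sup>2)"
    if "\<forall>n. \<tau> n \<in> {0<..}" for \<tau> :: "nat \<Rightarrow> real" and N
    using that by (intro maximal_evolution f) (auto intro: less_imp_le)
  show "bdd_above ((\<lambda>t. \<bar>evolution f n t\<bar>) ` {0<..})"
    using sum_SUP_le_of_choice(1)[of "{..<Suc n}" "{0<..}" "evolution f", OF _ _ choice] by auto
  have "(\<Sum>n\<in>{..<N}. (SUP t\<in>{0<..}. \<bar>evolution f n t\<bar>)\<^sup>2) \<le> 34 * (\<Sum>m. (f m)\<^sup>2)" for N
    by (rule sum_SUP_le_of_choice(2)[OF _ _ choice]) auto
  then show "summable (\<lambda>n. (SUP t\<in>{0<..}. \<bar>evolution f n t\<bar>)\<^sup>2)"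
    by (intro summableI_nonneg_bounded) auto
qed

text \<open>If \<open>c\<close> vanished beyond \<open>N\<close>, the sum would be \<open>\<integral>(x - 1) (\<Sum>\<^sub>n c\<^sub>n p\<^sub>n)\<^sup>2 dM \<le> 0\<close>. The value
  \<open>c (Suc N)\<close> enters only through the matrix entry \<open>a N \<le> 1\<close> in the row \<open>N\<close>.\<close>

lemma generator_form_le:
  "(\<Sum>n<Suc N. c n * generator c n) \<le> \<bar>c N\<bar> * \<bar>c (Suc N)\<bar>"
proof -
  define S where "S x = (\<Sum>n<Suc N. c n * p n x)" for x
  have S [continuous_intros]: "continuous_on A S" for A
    unfolding S_def[abs_def] by (intro continuous_intros)
  have coef: "(\<integral>x. p k x * S x \<partial>M) = (if k < Suc N then c k else 0)" for k
    using integral_sum_p_mult_p[of "{..<Suc N}" c k] by (simp add: mult.commute[of "p k _"] del: sum.lessThan_Suc flip: S_def)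
  have x_coef: "(\<integral>x. x * p n x * S x \<partial>M)
      = (if n = 0 then 0 else a (n - 1) * c (n - 1)) + b n * c n + (if n = N then 0 else a n * c (Suc n))"
    if "n < Suc N" for n
    using that by (subst integral_x_p_mult[OF S]) (auto simp: coef)
  have xS: "(\<integral>x. x * (S x)\<^sup>2 \<partial>M) = (\<Sum>n<Suc N. c n * (\<integral>x. x * p n x * S x \<partial>M))"
  proof -
    have "(\<integral>x. (\<Sum>n<Suc N. c n * p n x) * (x * S x) \<partial>M) = (\<Sum>n<Suc N. c n * (\<integral>x. p n x * (x * S x) \<partial>M))"
      by (intro integral_sum_p_mult continuous_intros)
    then show ?thesis unfolding S_def[symmetric] by (simp only: power2_eq_square mult_ac)
  qed
  have term_eq: "c n * generator c n
      = c n * ((\<integral>x. x * p n x * S x \<partial>M) - c n) + (if n = N then a N * c N * c (Suc N) else 0)"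
    if "n < Suc N" for n
    unfolding x_coef[OF that] generator_def by (simp add: algebra_simps)
  have "(\<Sum>n<Suc N. c n * generator c n)
      = (\<Sum>n<Suc N. c n * ((\<integral>x. x * p n x * S x \<partial>M) - c n) + (if n = N then a N * c N * c (Suc N) else 0))"
    by (intro sum.cong refl term_eq) simp
  also have "\<dots> = (\<integral>x. x * (S x)\<^sup>2 \<partial>M) - (\<integral>x. (S x)\<^sup>2 \<partial>M) + a N * c N * c (Suc N)"
  proof -
    have "(\<integral>x. (S x)\<^sup>2 \<partial>M) = (\<Sum>n<Suc N. (c n)\<^sup>2)"
      unfolding S_def by (rule integral_sum_p_sq) simp
    then show ?thesis
      unfolding xS by (simp add: sum.distrib sum_subtractf right_diff_distrib power2_eq_square del: sum.lessThan_Suc)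
  qed
  also have "(\<integral>x. x * (S x)\<^sup>2 \<partial>M) \<le> (\<integral>x. (S x)\<^sup>2 \<partial>M)"
  proof (rule integral_mono_cont)
    fix x :: real assume "x \<in> {-1..1}"
    then show "x * (S x)\<^sup>2 \<le> (S x)\<^sup>2" using mult_right_mono[of x 1 "(S x)\<^sup>2"] by simp
  qed (intro continuous_intros)+
  also have "a N * c N * c (Suc N) \<le> \<bar>a N * c N * c (Suc N)\<bar>" by simp
  also have "\<dots> \<le> \<bar>c N\<bar> * \<bar>c (Suc N)\<bar>"
    using a_nonneg[of N] a_le_1[of N] by (simp add: abs_mult mult.assoc mult_left_le_one_le)
  finally show ?thesis by simp
qed

text \<open>By \<open>generator_form_le\<close> the energy of the first \<open>N + 1\<close> components grows at most at the rate
  \<open>2 V\<^sub>N V\<^bsub>N+1\<^esub>\<close>, which tends to \<open>0\<close> as \<open>N\<close> grows.\<close>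

lemma evolution_unique_zero:
  assumes deriv: "\<And>n t. t \<ge> 0 \<Longrightarrow> (v n has_real_derivative generator (\<lambda>k. v k t) n) (at t within {0..})"
    and init: "\<And>n. v n 0 = 0"
    and bound: "\<And>n t. t > 0 \<Longrightarrow> \<bar>v n t\<bar> \<le> V n" and V: "summable (\<lambda>n. (V n)\<^sup>2)"
    and t: "t \<ge> 0"
  shows "v n t = 0"
proof -
  have V_nonneg: "V n \<ge> 0" for n using bound[of 1 n] by simp
  have "(\<lambda>n. (V n)\<^sup>2) \<longlonglongrightarrow> 0" by (rule summable_LIMSEQ_zero[OF V])
  then have "(\<lambda>n. sqrt ((V n)\<^sup>2)) \<longlonglongrightarrow> sqrt 0" by (rule tendsto_real_sqrt)
  then have V_lim: "V \<longlonglongrightarrow> 0" using V_nonneg by simp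
  have "(v n t)\<^sup>2 \<le> 2 * V N * V (Suc N) * t" if "N \<ge> n" for N
  proof -
    define E where "E s = (\<Sum>k<Suc N. (v k s)\<^sup>2) - 2 * V N * V (Suc N) * s" for s
    have E: "(E has_real_derivative 2 * (\<Sum>k<Suc N. v k s * generator (\<lambda>k. v k s) k) - 2 * V N * V (Suc N))
        (at s within {0..})" if "s \<ge> 0" for s
      unfolding E_def sum_distrib_left
      by (auto intro!: derivative_eq_intros deriv that sum.cong simp: mult_ac)
    \<comment> \<open>The subtracted linear term compensates the flow through the truncation, so \<open>E\<close> decreases.\<close>
    have "E t \<le> E 0"
    proof (rule DERIV_nonpos_imp_decreasing_open[OF t])
      fix s assume s: "0 < s" "s < t"
      have "(E has_real_derivative 2 * (\<Sum>k<Suc N. v k s * generator (\<lambda>k. v k s) k) - 2 * V N * V (Suc N)) (at s)"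
        using E[of s] s by (simp add: at_within_interior[of s "{0..}"])
      moreover have "(\<Sum>k<Suc N. v k s * generator (\<lambda>k. v k s) k) \<le> V N * V (Suc N)"
        using generator_form_le[where N = N and c = "\<lambda>k. v k s"] mult_mono[OF bound bound, of s s N "Suc N"] s V_nonneg
        by fastforce
      ultimately show "\<exists>y. (E has_real_derivative y) (at s) \<and> y \<le> 0"
        by (intro exI conjI) (assumption, simp)
    next
      have "continuous_on {0..} E"
        using E by (auto simp: continuous_on_eq_continuous_within intro: DERIV_continuous)
      then show "continuous_on {0..t} E" by (rule continuous_on_subset) auto
    qed
    then have "(\<Sum>k<Suc N. (v k t)\<^sup>2) \<le> 2 * V N * V (Suc N) * t"
      by (simp add: E_def init)
    moreover have "(v n t)\<^sup>2 \<le> (\<Sum>k<Suc N. (v k t)\<^sup>2)"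
      using that by (intro member_le_sum) auto
    ultimately show ?thesis by simp
  qed
  moreover have "(\<lambda>N. 2 * V N * V (Suc N) * t) \<longlonglongrightarrow> 2 * 0 * 0 * t"
    by (intro tendsto_mult tendsto_const V_lim LIMSEQ_Suc)
  ultimately have "(v n t)\<^sup>2 \<le> 2 * 0 * 0 * t"
    by (intro LIMSEQ_le_const) auto
  then show ?thesis by simp
qed

end

section \<open>The heat equation for Jacobi expansions\<close>

theorem proposition3p1:
  fixes \<alpha> \<beta> :: real and f :: "nat \<Rightarrow> real"
  assumes "\<alpha> > -1" and "\<beta> > -1" and "f \<in> l2"
  shows "(\<forall>t\<ge>0. \<forall>n. summable (\<lambda>m. f m * heat_kernel \<alpha> \<beta> t m n)) \<and>
         (\<lambda>n t. heat_W \<alpha> \<beta> t f n) \<in> l2_star \<and>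
         solves_heat_ivp \<alpha> \<beta> f (\<lambda>n t. heat_W \<alpha> \<beta> t f n) \<and>
         (\<forall>u. u \<in> l2_star \<and> solves_heat_ivp \<alpha> \<beta> f u \<longrightarrow>
              (\<forall>n. \<forall>t\<ge>0. u n t = heat_W \<alpha> \<beta> t f n))"
proof -
  note ab = assms(1,2)
  interpret jacobi_matrix_measure "jacobi_measure \<alpha> \<beta>" "jacobi_p \<alpha> \<beta>" "jacobi_a \<alpha> \<beta>" "jacobi_b \<alpha> \<beta>"
  proof (rule jacobi_matrix_measure.intro)
    show "finite_measure (jacobi_measure \<alpha> \<beta>)" by (rule finite_jacobi_measure[OF ab])
    show "AE x in jacobi_measure \<alpha> \<beta>. x \<in> {-1..1}" by (rule AE_jacobi_measure)
    show "continuous_on UNIV (jacobi_p \<alpha> \<beta> n)" for n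
      unfolding jacobi_p_eq by (intro continuous_intros)
    show "(\<integral>x. jacobi_p \<alpha> \<beta> m x * jacobi_p \<alpha> \<beta> n x \<partial>jacobi_measure \<alpha> \<beta>) = (if m = n then 1 else 0)" for m n
      using jacobi_opoly_orthonormal[OF ab, of m n] by (simp add: jacobi_p_eq jacobi_int_def)
    show "x * jacobi_p \<alpha> \<beta> n x =
       (if n = 0 then 0 else jacobi_a \<alpha> \<beta> (n - 1) * jacobi_p \<alpha> \<beta> (n - 1) x)
         + jacobi_b \<alpha> \<beta> n * jacobi_p \<alpha> \<beta> n x + jacobi_a \<alpha> \<beta> n * jacobi_p \<alpha> \<beta> (Suc n) x" for x n
      using arg_cong[OF jacobi_opoly_recurrence[OF ab, of n], of "\<lambda>q. poly q x"]
      by (auto simp: jacobi_p_eq)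
    show "jacobi_a \<alpha> \<beta> n \<ge> 0" for n by (rule jacobi_a_nonneg[OF ab])
  qed (rule sets_jacobi_measure)
  have kernel: "heat_kernel \<alpha> \<beta> = kernel"
    by (intro ext) (simp add: heat_kernel_def kernel_def mult.assoc)
  have W: "heat_W \<alpha> \<beta> t f n = evolution f n t" for t n
    by (simp add: heat_W_def evolution_def kernel)
  have calJ: "jacobi_calJ \<alpha> \<beta> = generator"
    by (intro ext) (simp add: jacobi_calJ_def jacobi_J_def generator_def algebra_simps)
  have f: "summable (\<lambda>n. (f n)\<^sup>2)" using assms(3) by (simp add: l2_def)
  have unique: "u n t = evolution f n t"
    if u: "u \<in> l2_star" "solves_heat_ivp \<alpha> \<beta> f u" and t: "t \<ge> 0" for u n t
  proof -
    let ?U = "\<lambda>n. SUP t\<in>{0<..}. \<bar>u n t\<bar>" and ?W = "\<lambda>n. SUP t\<in>{0<..}. \<bar>evolution f n t\<bar>"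
    have "u n t - evolution f n t = 0"
    proof (rule evolution_unique_zero[where V = "\<lambda>n. ?U n + ?W n" and v = "\<lambda>n t. u n t - evolution f n t"])
      fix n and t :: real assume "t \<ge> 0"
      then have "(u n has_real_derivative generator (\<lambda>k. u k t) n) (at t within {0..})"
        using u(2) by (simp add: solves_heat_ivp_def calJ)
      then have "((\<lambda>t. u n t - evolution f n t) has_real_derivative
          generator (\<lambda>k. u k t) n - generator (\<lambda>k. evolution f k t) n) (at t within {0..})"
        using evolution_has_derivative[OF f \<open>t \<ge> 0\<close>] by (rule DERIV_diff)
      then show "((\<lambda>t. u n t - evolution f n t) has_real_derivative
          generator (\<lambda>k. u k t - evolution f k t) n) (at t within {0..})"
        by (rule DERIV_cong) (simp add: generator_def algebra_simps)
    next
      show "u n 0 - evolution f n 0 = 0" for n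
        using u(2) by (simp add: solves_heat_ivp_def evolution_0)
    next
      fix n and t :: real assume "t > 0"
      then have "\<bar>u n t\<bar> \<le> ?U n" "\<bar>evolution f n t\<bar> \<le> ?W n"
        using u(1) evolution_maximal_function(1)[OF f]
        by (auto simp: l2_star_def intro!: cSUP_upper)
      then show "\<bar>u n t - evolution f n t\<bar> \<le> ?U n + ?W n" by linarith
    next
      have "summable (\<lambda>n. 2 * (?U n)\<^sup>2 + 2 * (?W n)\<^sup>2)"
        using u(1) evolution_maximal_function(2)[OF f]
        by (intro summable_add summable_mult) (auto simp: l2_star_def l2_def)
      then show "summable (\<lambda>n. (?U n + ?W n)\<^sup>2)"
      proof (rule summable_comparison_test')
        fix n
        have "(?U n + ?W n)\<^sup>2 \<le> 2 * (?U n)\<^sup>2 + 2 * (?W n)\<^sup>2"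
          using sum_squares_bound[of "?U n" "?W n"] by (simp add: power2_sum)
        then show "norm ((?U n + ?W n)\<^sup>2) \<le> 2 * (?U n)\<^sup>2 + 2 * (?W n)\<^sup>2" by simp
      qed
    qed (rule t)
    then show ?thesis by simp
  qed
  show ?thesis
    unfolding W
  proof (intro conjI)
    show "\<forall>t\<ge>0. \<forall>n. summable (\<lambda>m. f m * heat_kernel \<alpha> \<beta> t m n)"
      using summable_kernel[OF f] by (simp add: kernel)
    show "(\<lambda>n t. evolution f n t) \<in> l2_star"
      using evolution_maximal_function[OF f] by (simp add: l2_star_def l2_def)
    show "solves_heat_ivp \<alpha> \<beta> f (\<lambda>n t. evolution f n t)"
      using evolution_has_derivative[OF f] by (simp add: solves_heat_ivp_def calJ evolution_0)
    show "\<forall>u. u \<in> l2_star \<and> solves_heat_ivp \<alpha> \<beta> f u \<longrightarrow> (\<forall>n. \<forall>t\<ge>0. u n t = evolution f n t)"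
      using unique by blast
  qed
qed

end
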